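(* Let $q$ be an odd prime power. There are exactly $3$ equivalence classes of $\mathbb{F}_q$-linear complete symmetric rank-distance (CSRD) codes in $M_{3\times 3}(\mathbb{F}_q)$ of minimum distance $2$. Moreover, every $\mathbb{F}_q$-linear CSRD code in $M_{3\times 3}(\mathbb{F}_q)$ of minimum distance $2$ is an MSRD code, i.e. has dimension $4$.
   Context: Let $\mathrm{Sym}_3(\mathbb{F}_q)$ denote the $6$-dimensional $\mathbb{F}_q$-space of symmetric $3\times 3$ matrices over $\mathbb{F}_q$. An $\mathbb{F}_q$-linear symmetric rank-distance (SRD) code is an $\mathbb{F}_q$-subspace $C\subseteq \mathrm{Sym}_3(\mathbb{F}_q)$ with $|C|\ge 2$; its minimum distance is $d=\min\{\mathrm{rank}(X-Y): X,Y\in C, X\neq Y\}$, i.e. the minimum rank of a nonzero element of $C$. For $3\times 3$ matrices, an $\mathbb{F}_q$-linear SRD code of minimum distance $2$ has dimension at most $4$, and it is called an MSRD code if its dimension equals $4$. An $\mathbb{F}_q$-linear SRD code of minimum distance $d$ is complete (CSRD) if it is not contained in a strictly larger $\mathbb{F}_q$-linear SRD code in $\mathrm{Sym}_3(\mathbb{F}_q)$ of minimum distance $d$. Two codes $C,C'$ are equivalent if $C'=\{AXB: X\in C\}$ for some $A,B\in \mathrm{GL}(3,q)$. *)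

theory Defs
  imports "HOL-Analysis.Analysis"
begin

text \<open>
  The finite field is a type of sort \<open>{field, finite}\<close>; its order \<open>q\<close> is the cardinality of
  the type. The library has no scalar multiplication of matrices over an arbitrary field.
\<close>

definition mat_scale :: "'a::field \<Rightarrow> 'a^'n^'m \<Rightarrow> 'a^'n^'m"
  where "mat_scale c X = map_matrix (\<lambda>x. c * x) X"

interpretation matvs: vector_space "mat_scale :: 'a::field \<Rightarrow> 'a^'n^'m \<Rightarrow> 'a^'n^'m"
  by unfold_locales (simp_all add: mat_scale_def vec_eq_iff algebra_simps)

definition Sym3 :: "('a::{field,finite}^3^3) set"
  where "Sym3 = {X. transpose X = X}"

definition linear_SRD :: "('a::{field,finite}^3^3) set \<Rightarrow> bool"
  where "linear_SRD C \<longleftrightarrow> matvs.subspace C \<and> C \<subseteq> Sym3 \<and> card C \<ge> 2"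

text \<open>
  The set below is finite, and it is nonempty as soon as \<open>card C \<ge> 2\<close>; \<open>min_distance\<close> is only
  meaningful in that case.
\<close>

definition min_distance :: "('a::{field,finite}^3^3) set \<Rightarrow> nat"
  where "min_distance C = Min {rank (X - Y) | X Y. X \<in> C \<and> Y \<in> C \<and> X \<noteq> Y}"

definition linear_CSRD :: "nat \<Rightarrow> ('a::{field,finite}^3^3) set \<Rightarrow> bool"
  where "linear_CSRD d C \<longleftrightarrow> linear_SRD C \<and> min_distance C = d \<and>
    \<not> (\<exists>D. linear_SRD D \<and> min_distance D = d \<and> C \<subset> D)"

text \<open>
  Only minimum distance 2 is covered: in that case 4 is the largest possible dimension of a
  linear SRD code of \<open>3 \<times> 3\<close> matrices.
\<close>

definition linear_MSRD2 :: "('a::{field,finite}^3^3) set \<Rightarrow> bool"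
  where "linear_MSRD2 C \<longleftrightarrow> linear_SRD C \<and> min_distance C = 2 \<and> matvs.dim C = 4"

definition code_equivalent :: "('a::{field,finite}^3^3) set \<Rightarrow> ('a^3^3) set \<Rightarrow> bool"
  where "code_equivalent C C' \<longleftrightarrow>
    (\<exists>A B. invertible A \<and> invertible B \<and> C' = {A ** X ** B | X. X \<in> C})"

definition CSRD_codes :: "nat \<Rightarrow> ('a::{field,finite}^3^3) set set"
  where "CSRD_codes d = {C. linear_CSRD d C}"

definition CSRD_equiv :: "nat \<Rightarrow> (('a::{field,finite}^3^3) set \<times> ('a^3^3) set) set"
  where "CSRD_equiv d =
    {(C, C'). C \<in> CSRD_codes d \<and> C' \<in> CSRD_codes d \<and> code_equivalent C C'}"

lemma code_equivalent_refl: "code_equivalent C C"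
  unfolding code_equivalent_def
  by (rule exI[of _ "mat 1"], rule exI[of _ "mat 1"]) (auto simp: invertible_def)

lemma code_equivalent_sym:
  assumes "code_equivalent C D"
  shows "code_equivalent D C"
proof -
  obtain A B where inv: "invertible A" "invertible B" and D: "D = {A ** X ** B | X. X \<in> C}"
    using assms unfolding code_equivalent_def by blast
  obtain A' where A': "A ** A' = mat 1" "A' ** A = mat 1"
    using inv(1) unfolding invertible_def by blast
  obtain B' where B': "B ** B' = mat 1" "B' ** B = mat 1"
    using inv(2) unfolding invertible_def by blast
  have *: "A' ** (A ** X ** B) ** B' = X" for X
    by (metis A'(2) B'(1) matrix_mul_assoc matrix_mul_lid matrix_mul_rid)
  have "{A' ** Y ** B' | Y. Y \<in> D} = (\<lambda>X. A' ** (A ** X ** B) ** B') ` C"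
    unfolding D by blast
  then have "C = {A' ** Y ** B' | Y. Y \<in> D}"
    by (simp only: * image_ident)
  moreover have "invertible A'" "invertible B'"
    using A' B' unfolding invertible_def by blast+
  ultimately show ?thesis
    unfolding code_equivalent_def by blast
qed

lemma code_equivalent_trans:
  assumes "code_equivalent C D" "code_equivalent D E"
  shows "code_equivalent C E"
proof -
  obtain A B where 1: "invertible A" "invertible B" "D = {A ** X ** B | X. X \<in> C}"
    using assms(1) unfolding code_equivalent_def by blast
  obtain A' B' where 2: "invertible A'" "invertible B'" "E = {A' ** X ** B' | X. X \<in> D}"
    using assms(2) unfolding code_equivalent_def by blast
  have "E = (\<lambda>X. A' ** (A ** X ** B) ** B') ` C"
    unfolding 2(3) 1(3) by blast
  also have "\<dots> = (\<lambda>X. (A' ** A) ** X ** (B ** B')) ` C"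
    by (simp only: matrix_mul_assoc)
  also have "\<dots> = {(A' ** A) ** X ** (B ** B') | X. X \<in> C}"
    by blast
  finally have "E = {(A' ** A) ** X ** (B ** B') | X. X \<in> C}" .
  then show ?thesis
    unfolding code_equivalent_def using 1 2 invertible_mult by blast
qed

lemma equiv_CSRD_equiv: "equiv (CSRD_codes d) (CSRD_equiv d)"
  by (rule equivI)
    (auto simp: CSRD_equiv_def refl_on_def sym_def trans_def
      intro: code_equivalent_refl code_equivalent_sym code_equivalent_trans)

end

theory Submission
  imports Defs
begin

text \<open>
  Pair symmetric matrices with quadratic forms by \<open>\<langle>P, X\<rangle> = tr (P X)\<close>; then \<open>\<langle>P, x x\<^sup>T\<rangle> = P(x)\<close>, so a subspace
  contains no matrix of rank one iff the forms annihilating it have no common zero. A single ternary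
  form has a zero, hence such a subspace has codimension at least two, and a counting argument in the
  quotient shows that one containing a rank-two matrix can be enlarged until its codimension is exactly
  two. The complete codes are therefore the annihilators of pencils of conics without base points.

  Let \<open>n\<close> be a nonsquare. If some member of the pencil contains a line, completing squares leads to
  \<open>\<langle>x\<^sup>2, y\<^sup>2 - n z\<^sup>2\<rangle>\<close> or \<open>\<langle>x y, z\<^sup>2 - n (x\<^sup>2 + y\<^sup>2)\<rangle>\<close>. Otherwise a singular member still exists, because
  \<open>q + 1\<close> disjoint nonsingular conics would have more than \<open>q\<^sup>2 + q + 1\<close> points, and the pencil becomes
  \<open>\<langle>x\<^sup>2 - n y\<^sup>2, z\<^sup>2 + b y\<^sup>2 + 2 d x y\<rangle>\<close> with \<open>b\<^sup>2 - 4 n d\<^sup>2\<close> a nonsquare; any two such pencils are equivalent.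
  The three codes are told apart by the number of directions \<open>v\<close> for which the matrices of the code
  that annihilate \<open>v\<close> form a space of dimension at least two: it is 1, 2 and 0 respectively.
\<close>

section \<open>Squares in finite fields of odd order\<close>

text \<open>Translation by 1 permutes the field, so the sum of all elements does not change when 1
  is added q times.\<close>

lemma of_nat_CARD_eq_0: "of_nat CARD('a::{field,finite}) = (0::'a)"
proof -
  have "bij (\<lambda>x::'a. x + 1)"
    by (rule o_bij[of "\<lambda>x. x - 1"]) (auto simp: o_def)
  then have "(\<Sum>x\<in>UNIV. x + 1) = (\<Sum>x\<in>UNIV. x::'a)"
    by (rule sum.reindex_bij_betw)
  then show ?thesis
    by (simp add: sum.distrib)
qed

lemma two_neq_0_of_odd_CARD:
  assumes "odd CARD('a::{field,finite})"
  shows "(2::'a) \<noteq> 0"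
proof
  assume two: "(2::'a) = 0"
  obtain k where "CARD('a) = 2 * k + 1"
    using assms by (elim oddE)
  then have "of_nat CARD('a) = (2 * of_nat k + 1 :: 'a)"
    by simp
  then show False
    using two of_nat_CARD_eq_0[where 'a='a] by simp
qed

lemma CARD_field_ge_2: "CARD('a::{field,finite}) \<ge> 2"
proof -
  have "card {0, 1::'a} \<le> CARD('a)"
    by (rule card_mono) auto
  then show ?thesis
    by simp
qed

text \<open>The fibres of squaring have two elements over a nonzero square, since r \<noteq> -r, and
  one element over 0.\<close>

lemma card_squares:
  assumes two: "(2::'a::{field,finite}) \<noteq> 0"
  shows "2 * card (range (\<lambda>x::'a. x\<^sup>2)) = CARD('a) + 1"
proof -
  let ?S = "range (\<lambda>x::'a. x\<^sup>2)"
  have fib: "card {x::'a. x\<^sup>2 = y} = 2" if y: "y \<in> ?S - {0}" for y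
  proof -
    obtain r where r: "y = r\<^sup>2" "r \<noteq> 0"
      using y by auto
    have "r \<noteq> - r"
      using r(2) two by (metis add.inverse_unique add_eq_0_iff mult_2 mult_eq_0_iff)
    moreover have "{x. x\<^sup>2 = y} = {r, - r}"
      using r by (auto simp: power2_eq_iff)
    ultimately show ?thesis
      by simp
  qed
  have "CARD('a) = (\<Sum>y\<in>?S. card {x::'a. x\<^sup>2 = y})"
    using sum.image_gen[of "UNIV::'a set" "\<lambda>_. 1::nat" "\<lambda>x. x\<^sup>2"] by simp
  also have "\<dots> = card {x::'a. x\<^sup>2 = 0} + (\<Sum>y\<in>?S - {0}. card {x::'a. x\<^sup>2 = y})"
    by (rule sum.remove) (auto intro: range_eqI[of _ _ 0])
  also have "\<dots> = 1 + 2 * card (?S - {0})"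
    using fib by simp
  also have "card (?S - {0}) = card ?S - 1"
    by (rule card_Diff_singleton) (auto intro: range_eqI[of _ _ 0])
  finally show ?thesis
    using card_gt_0_iff[of ?S] by simp
qed

text \<open>By \<open>card_squares\<close> the set S of squares and the set n S have (q + 1)/2
  elements each and share only 0, so together they exhaust the field; a nonsquare must lie in n
  S.\<close>

lemma nonsquare_quotient_square:
  fixes n m :: "'a::{field,finite}"
  assumes two: "(2::'a) \<noteq> 0" and n: "\<nexists>r. n = r\<^sup>2" and m: "\<nexists>r. m = r\<^sup>2"
  obtains r where "r \<noteq> 0" "m = n * r\<^sup>2"
proof -
  let ?S = "range (\<lambda>x::'a. x\<^sup>2)"
  have n0: "n \<noteq> 0"
    using n by (metis power_zero_numeral)
  have "x = 0" if x: "x \<in> ?S" "x \<in> (*) n ` ?S" for x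
  proof (rule ccontr)
    assume "x \<noteq> 0"
    moreover obtain r s where "x = r\<^sup>2" "x = n * s\<^sup>2"
      using x by blast
    ultimately have "n = (r / s)\<^sup>2"
      by (cases "s = 0") (auto simp: power_divide field_simps)
    then show False
      using n by blast
  qed
  then have "?S \<inter> (*) n ` ?S = {0}"
    by (auto simp: image_iff intro: exI[of _ 0])
  then have "card (?S \<union> (*) n ` ?S) + 1 = card ?S + card ((*) n ` ?S)"
    using card_Un_Int[of ?S "(*) n ` ?S"] by simp
  also have "card ((*) n ` ?S) = card ?S"
    by (rule card_image) (use n0 in \<open>auto simp: inj_on_def\<close>)
  finally have "card (?S \<union> (*) n ` ?S) = CARD('a)"
    using card_squares[OF two] by simp
  then have "?S \<union> (*) n ` ?S = UNIV"
    by (intro card_eq_UNIV_imp_eq_UNIV) auto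
  then have "m \<in> (*) n ` ?S"
    using m by blast
  then obtain r where "m = n * r\<^sup>2"
    by auto
  moreover have "r \<noteq> 0"
    using calculation m by (metis mult_zero_right power_zero_numeral)
  ultimately show ?thesis
    using that by blast
qed

lemma exists_nonsquare:
  assumes two: "(2::'a::{field,finite}) \<noteq> 0"
  obtains n :: "'a::{field,finite}" where "\<nexists>r. n = r\<^sup>2"
proof -
  have "range (\<lambda>x::'a. x\<^sup>2) \<noteq> UNIV"
  proof
    assume "range (\<lambda>x::'a. x\<^sup>2) = UNIV"
    then show False
      using card_squares[OF two] CARD_field_ge_2[where 'a='a] by simp
  qed
  then show ?thesis
    using that by blast
qed

text \<open>Pigeonhole: the values of a x^2 and of c - b y^2 form two sets of (q + 1)/2 elements
  each, too many to be disjoint.\<close>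

lemma diagonal_binary_form_universal:
  fixes a b c :: "'a::{field,finite}"
  assumes two: "(2::'a) \<noteq> 0" and "a \<noteq> 0" "b \<noteq> 0"
  obtains x y where "a * x\<^sup>2 + b * y\<^sup>2 = c"
proof -
  let ?S = "range (\<lambda>x::'a. x\<^sup>2)"
  let ?A = "(\<lambda>s. a * s) ` ?S" and ?B = "(\<lambda>s. c - b * s) ` ?S"
  have cA: "card ?A = card ?S" and cB: "card ?B = card ?S"
    by (rule card_image, use assms in \<open>auto simp: inj_on_def\<close>)+
  have "?A \<inter> ?B \<noteq> {}"
  proof
    assume "?A \<inter> ?B = {}"
    then have "card ?A + card ?B = card (?A \<union> ?B)"
      by (simp add: card_Un_disjoint)
    also have "\<dots> \<le> CARD('a)"
      by (rule card_mono) auto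
    finally show False
      using card_squares[OF two] cA cB by simp
  qed
  then obtain x y where "a * x\<^sup>2 = c - b * y\<^sup>2"
    by auto
  then show ?thesis
    using that[of x y] by simp
qed

text \<open>
  In terms of the quadratic extension by \<open>\<surd>n\<close>: the element \<open>p + 2r\<surd>n\<close> is a square
  as soon as its norm is one.
\<close>

lemma square_norm_imp_square:
  fixes n p r w :: "'a::{field,finite}"
  assumes two: "(2::'a) \<noteq> 0" and n: "\<nexists>r. n = r\<^sup>2"
    and norm: "p\<^sup>2 - 4 * n * r\<^sup>2 = w\<^sup>2"
  obtains u v where "v\<^sup>2 + n * u\<^sup>2 = p" "u * v = r"
proof (cases "r = 0")
  case True
  show ?thesis
  proof (cases "\<exists>s. p = s\<^sup>2")
    case True
    then obtain s where "p = s\<^sup>2" by blast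
    with \<open>r = 0\<close> show ?thesis
      using that[of s 0] by simp
  next
    case False
    then obtain s where "p = n * s\<^sup>2"
      using nonsquare_quotient_square[OF two n] by blast
    with \<open>r = 0\<close> show ?thesis
      using that[of 0 s] by simp
  qed
next
  case r0: False
  note result = that
  \<comment> \<open>The product (p + w')(p - w') equals 4 n r^2. If (p + w')/2 = v^2, then (p -
    w')/2 = n (r/v)^2, and the two add up to p; hence the witnesses r/v and v.\<close>
  have root: thesis if a: "(p + w') / 2 = v\<^sup>2" and w': "w'\<^sup>2 = w\<^sup>2" for w' v
  proof -
    have p: "p + w' = 2 * v\<^sup>2"
      using a two by (simp add: field_simps)
    have n0: "n \<noteq> 0"
      using n by (metis power_zero_numeral)
    have prod: "(p + w') * (p - w') = 4 * n * r\<^sup>2"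
      using norm w' by (simp add: algebra_simps power2_eq_square)
    have four: "(4::'a) \<noteq> 0"
      using two by (metis mult_2 mult_eq_0_iff numeral_Bit0)
    have v0: "v \<noteq> 0"
      using prod p r0 n0 four by auto
    have "2 * v\<^sup>2 * (p - (2 * v\<^sup>2 - p)) = 4 * n * r\<^sup>2"
      using prod p by (metis add_diff_cancel_left')
    then have "4 * (v\<^sup>2 * (p - v\<^sup>2)) = 4 * (n * r\<^sup>2)"
      by (simp add: algebra_simps)
    then have "v\<^sup>2 * (p - v\<^sup>2) = n * r\<^sup>2"
      using four by simp
    then have "v\<^sup>2 + n * (r / v)\<^sup>2 = p"
      using v0 by (simp add: field_simps power2_eq_square)
    then show ?thesis
      using result[of v "r / v"] v0 by simp
  qed
  show ?thesis
  proof (cases "\<exists>v. (p + w) / 2 = v\<^sup>2")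
    case True
    then show ?thesis using root by blast
  next
    case False
    \<comment> \<open>(p + w)/2 times (p - w)/2 is n r^2, so when the first factor is a nonsquare
      the second is a square, and \<open>root\<close> applies to -w.\<close>
    then obtain s where s: "s \<noteq> 0" "(p + w) / 2 = n * s\<^sup>2"
      using nonsquare_quotient_square[OF two n] by blast
    have n0: "n \<noteq> 0"
      using n by (metis power_zero_numeral)
    have "(p + w) * (p - w) = 4 * n * r\<^sup>2"
      using norm by (simp add: algebra_simps power2_eq_square)
    moreover have "p + w = 2 * (n * s\<^sup>2)"
      using s two by (simp add: field_simps)
    ultimately have "(2 * n) * (s\<^sup>2 * (p - w)) = (2 * n) * (2 * r\<^sup>2)"
      by (simp add: algebra_simps)
    then have "s\<^sup>2 * (p - w) = 2 * r\<^sup>2"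
      using two n0 by (simp only: mult_cancel_left) simp
    then have "(p + - w) / 2 = (r / s)\<^sup>2"
      using s two by (simp add: field_simps power2_eq_square)
    then show ?thesis
      using root[of "- w"] by simp
  qed
qed

section \<open>Cardinalities of subspaces of matrices\<close>

lemma card_span_insert:
  fixes b :: "'a::{field,finite}^'n^'m"
  assumes "b \<notin> matvs.span B"
  shows "card (matvs.span (insert b B)) = CARD('a) * card (matvs.span B)"
proof -
  let ?f = "\<lambda>(k, x). x + mat_scale k b"
  have "matvs.span (insert b B) = ?f ` (UNIV \<times> matvs.span B)"
  proof (intro equalityI subsetI)
    fix x assume "x \<in> matvs.span (insert b B)"
    then obtain k where "x - mat_scale k b \<in> matvs.span B"
      by (auto simp: matvs.span_breakdown_eq)
    then show "x \<in> ?f ` (UNIV \<times> matvs.span B)"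
      by (intro image_eqI[of _ _ "(k, x - mat_scale k b)"]) auto
  next
    fix x assume "x \<in> ?f ` (UNIV \<times> matvs.span B)"
    then obtain k y where "x = y + mat_scale k b" "y \<in> matvs.span B"
      by auto
    then show "x \<in> matvs.span (insert b B)"
      by (auto simp: matvs.span_breakdown_eq intro!: exI[of _ k])
  qed
  moreover have "inj_on ?f (UNIV \<times> matvs.span B)"
  proof (rule inj_onI, clarify)
    fix k x l y
    assume x: "x \<in> matvs.span B" and y: "y \<in> matvs.span B"
      and eq: "x + mat_scale k b = y + mat_scale l b"
    have d: "mat_scale (k - l) b = y - x"
      using eq by (simp add: matvs.scale_left_diff_distrib algebra_simps)
    have "k = l"
    proof (rule ccontr)
      assume "k \<noteq> l"
      then have "b = mat_scale (inverse (k - l)) (mat_scale (k - l) b)"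
        by simp
      also have "\<dots> \<in> matvs.span B"
        unfolding d using x y by (intro matvs.span_scale matvs.span_diff)
      finally show False using assms by blast
    qed
    then show "k = l \<and> x = y"
      using eq by simp
  qed
  ultimately show ?thesis
    by (simp add: card_image card_cartesian_product)
qed

lemma card_span_independent:
  fixes B :: "('a::{field,finite}^'n^'m) set"
  assumes "matvs.independent B"
  shows "card (matvs.span B) = CARD('a) ^ card B"
proof -
  have "finite B" by simp
  then show ?thesis using assms
  proof (induction B)
    case empty
    then show ?case by simp
  next
    case (insert b B)
    then have "b \<notin> matvs.span B" "matvs.independent B"
      by (auto simp: matvs.independent_insert)
    then show ?case
      using insert card_span_insert[of b B] by simp
  qed
qed

lemma card_subspace_eq_power_dim:
  fixes C :: "('a::{field,finite}^'n^'m) set"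
  assumes "matvs.subspace C"
  shows "card C = CARD('a) ^ matvs.dim C"
proof -
  obtain B where B: "B \<subseteq> C" "matvs.independent B" "C \<subseteq> matvs.span B" "card B = matvs.dim C"
    by (rule matvs.basis_exists)
  then have "matvs.span B = C"
    using assms by (metis matvs.span_minimal subset_antisym)
  then show ?thesis
    using card_span_independent[OF B(2)] B(4) by simp
qed

section \<open>Symmetric matrices and pencils of conics\<close>

text \<open>As a conic: a x^2 + b y^2 + c z^2 + 2 (d x y + e x z + f y z). The last three arguments
  are thus half the mixed coefficients.\<close>

definition sym_mat :: "'a::zero \<Rightarrow> 'a \<Rightarrow> 'a \<Rightarrow> 'a \<Rightarrow> 'a \<Rightarrow> 'a \<Rightarrow> 'a^3^3"
  where "sym_mat a b c d e f = vector [vector [a, d, e], vector [d, b, f], vector [e, f, c]]"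

definition col_mat :: "'a::zero^3 \<Rightarrow> 'a^3 \<Rightarrow> 'a^3 \<Rightarrow> 'a^3^3"
  where "col_mat u v w = transpose (vector [u, v, w])"

definition outer :: "'a::field^3 \<Rightarrow> 'a^3^3"
  where "outer x = (\<chi> i j. x $ i * x $ j)"

definition qform :: "'a::field^3^3 \<Rightarrow> 'a^3 \<Rightarrow> 'a"
  where "qform P x = trace (P ** outer x)"

definition pencil_perp :: "'a::{field,finite}^3^3 \<Rightarrow> 'a^3^3 \<Rightarrow> ('a^3^3) set"
  where "pencil_perp P Q = {X \<in> Sym3. trace (P ** X) = 0 \<and> trace (Q ** X) = 0}"

definition base_free :: "'a::field^3^3 \<Rightarrow> 'a^3^3 \<Rightarrow> bool"
  where "base_free P Q \<longleftrightarrow> (\<forall>x. qform P x = 0 \<longrightarrow> qform Q x = 0 \<longrightarrow> x = 0)"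

lemma Sym3_iff: "X \<in> Sym3 \<longleftrightarrow> X$2$1 = X$1$2 \<and> X$3$1 = X$1$3 \<and> X$3$2 = X$2$3"
  by (auto simp: Sym3_def vec_eq_iff forall_3 transpose_def)

lemma sym_mat_nth [simp]:
  "sym_mat a b c d e f $ 1 $ 1 = a" "sym_mat a b c d e f $ 1 $ 2 = d" "sym_mat a b c d e f $ 1 $ 3 = e"
  "sym_mat a b c d e f $ 2 $ 1 = d" "sym_mat a b c d e f $ 2 $ 2 = b" "sym_mat a b c d e f $ 2 $ 3 = f"
  "sym_mat a b c d e f $ 3 $ 1 = e" "sym_mat a b c d e f $ 3 $ 2 = f" "sym_mat a b c d e f $ 3 $ 3 = c"
  by (simp_all add: sym_mat_def)

lemma sym_mat_in_Sym3 [simp]: "sym_mat a b c d e f \<in> Sym3"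
  by (simp add: Sym3_iff)

lemma sym_mat_eq_iff [simp]:
  "sym_mat a b c d e f = sym_mat a' b' c' d' e' f' \<longleftrightarrow>
    a = a' \<and> b = b' \<and> c = c' \<and> d = d' \<and> e = e' \<and> f = f'"
  by (auto simp: vec_eq_iff forall_3)

lemma sym_mat_eq_0_iff [simp]:
  "sym_mat a b c d e f = 0 \<longleftrightarrow> a = 0 \<and> b = 0 \<and> c = 0 \<and> d = 0 \<and> e = 0 \<and> f = 0"
  by (auto simp: vec_eq_iff forall_3)

lemma Sym3E:
  assumes "X \<in> Sym3"
  obtains a b c d e f where "X = sym_mat a b c d e f"
proof
  show "X = sym_mat (X$1$1) (X$2$2) (X$3$3) (X$1$2) (X$1$3) (X$2$3)"
    using assms by (simp add: Sym3_iff vec_eq_iff forall_3)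
qed

lemma sym_mat_add [simp]:
  "sym_mat a b c d e f + sym_mat a' b' c' d' e' f' =
    sym_mat (a + a') (b + b') (c + c') (d + d') (e + e') (f + f')"
  by (simp add: vec_eq_iff forall_3)

lemma mat_scale_nth [simp]: "mat_scale k X $ i $ j = k * X $ i $ j"
  by (simp add: mat_scale_def)

lemma mat_scale_sym_mat [simp]:
  "mat_scale k (sym_mat a b c d e f) = sym_mat (k * a) (k * b) (k * c) (k * d) (k * e) (k * f)"
  by (simp add: vec_eq_iff forall_3)

lemma trace_sym_mat_mult:
  fixes a :: "'a::comm_ring_1"
  shows "trace (sym_mat a b c d e f ** sym_mat a' b' c' d' e' f') =
    a * a' + b * b' + c * c' + 2 * (d * d' + e * e' + f * f')"
  by (simp add: trace_def matrix_matrix_mult_def sum_3 algebra_simps)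

lemma det_sym_mat:
  fixes a :: "'a::comm_ring_1"
  shows "det (sym_mat a b c d e f) = a * b * c + 2 * d * e * f - a * f\<^sup>2 - b * e\<^sup>2 - c * d\<^sup>2"
  by (simp add: det_3 algebra_simps power2_eq_square)

lemma outer_vector:
  "outer (vector [x, y, z]) = sym_mat (x\<^sup>2) (y\<^sup>2) (z\<^sup>2) (x * y) (x * z) (y * z)"
  by (simp add: outer_def vec_eq_iff forall_3 power2_eq_square)

lemma outer_in_Sym3 [simp]: "outer x \<in> Sym3"
  by (simp add: Sym3_iff outer_def)

lemma qform_sym_mat [simp]:
  "qform (sym_mat a b c d e f) (vector [x, y, z]) =
    a * x\<^sup>2 + b * y\<^sup>2 + c * z\<^sup>2 + 2 * (d * (x * y) + e * (x * z) + f * (y * z))"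
  by (simp add: qform_def outer_vector trace_sym_mat_mult)

lemma vector3_eq_0_iff [simp]: "(vector [x, y, z] :: 'a::zero^3) = 0 \<longleftrightarrow> x = 0 \<and> y = 0 \<and> z = 0"
  by (simp add: vec_eq_iff forall_3)

lemma vector3_eq_iff [simp]:
  "(vector [x, y, z] :: 'a::zero^3) = vector [x', y', z'] \<longleftrightarrow> x = x' \<and> y = y' \<and> z = z'"
  by (simp add: vec_eq_iff forall_3)

lemma vector3_cases:
  obtains x y z where "(v :: 'a::zero^3) = vector [x, y, z]"
proof
  show "v = vector [v$1, v$2, v$3]"
    by (simp add: vec_eq_iff forall_3)
qed

lemma base_freeD_vector:
  assumes "base_free P Q" "qform P (vector [x, y, z]) = 0" "qform Q (vector [x, y, z]) = 0"
  shows "x = 0 \<and> y = 0 \<and> z = 0"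
  using assms unfolding base_free_def by (metis vector3_eq_0_iff)

lemma det_col_mat [simp]:
  fixes u1 :: "'a::comm_ring_1"
  shows "det (col_mat (vector [u1, u2, u3]) (vector [v1, v2, v3]) (vector [w1, w2, w3])) =
    u1 * (v2 * w3 - v3 * w2) - v1 * (u2 * w3 - u3 * w2) + w1 * (u2 * v3 - u3 * v2)"
  by (simp add: col_mat_def det_3 transpose_def algebra_simps)

text \<open>\<open>B\<close> is the bilinear form of the matrix, evaluated on pairs of columns. As a
  rewrite rule this lets explicit changes of coordinates be checked entry by entry.\<close>

lemma congruence_sym_mat:
  fixes a :: "'a::comm_ring_1"
  defines "B \<equiv> \<lambda>a b c d e f p1 p2 p3 r1 r2 r3.
    a * p1 * r1 + b * p2 * r2 + c * p3 * r3 + d * (p1 * r2 + p2 * r1)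
      + e * (p1 * r3 + p3 * r1) + f * (p2 * r3 + p3 * r2)"
  shows "transpose (col_mat (vector [u1, u2, u3]) (vector [v1, v2, v3]) (vector [w1, w2, w3]))
      ** sym_mat a b c d e f
      ** col_mat (vector [u1, u2, u3]) (vector [v1, v2, v3]) (vector [w1, w2, w3]) =
    sym_mat (B a b c d e f u1 u2 u3 u1 u2 u3) (B a b c d e f v1 v2 v3 v1 v2 v3)
      (B a b c d e f w1 w2 w3 w1 w2 w3) (B a b c d e f u1 u2 u3 v1 v2 v3)
      (B a b c d e f u1 u2 u3 w1 w2 w3) (B a b c d e f v1 v2 v3 w1 w2 w3)"
  by (simp add: vec_eq_iff forall_3 matrix_matrix_mult_def sum_3 transpose_def col_mat_def
      B_def algebra_simps)

section \<open>Changes of coordinates and changes of basis of a pencil\<close>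

lemma trace_congruence:
  fixes P :: "'a::comm_ring_1^3^3"
  shows "trace (transpose A ** P ** A ** X) = trace (P ** (A ** X ** transpose A))"
proof -
  have "trace (transpose A ** P ** A ** X) = trace (transpose A ** (P ** A ** X))"
    by (simp add: matrix_mul_assoc)
  also have "\<dots> = trace (P ** A ** X ** transpose A)"
    by (rule trace_mul_sym)
  finally show ?thesis
    by (simp add: matrix_mul_assoc)
qed

lemma outer_mult: "outer (A *v x) = A ** outer x ** transpose A"
  by (simp add: outer_def vec_eq_iff forall_3 matrix_matrix_mult_def matrix_vector_mult_def
      sum_3 transpose_def algebra_simps)

lemma qform_congruence: "qform (transpose A ** P ** A) x = qform P (A *v x)"
  by (simp add: qform_def outer_mult trace_congruence)

lemma congruence_in_Sym3: "X \<in> Sym3 \<Longrightarrow> A ** X ** transpose A \<in> Sym3"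
  by (simp add: Sym3_def matrix_transpose_mul matrix_mul_assoc)

lemma congruence_in_Sym3': "X \<in> Sym3 \<Longrightarrow> transpose A ** X ** A \<in> Sym3"
  using congruence_in_Sym3[of X "transpose A"] by simp

lemma trace_comb:
  fixes P :: "'a::field^3^3"
  shows "trace ((mat_scale a P + mat_scale b Q) ** X) = a * trace (P ** X) + b * trace (Q ** X)"
  by (simp add: trace_def matrix_matrix_mult_def sum_3 algebra_simps)

lemma qform_comb:
  "qform (mat_scale a P + mat_scale b Q) x = a * qform P x + b * qform Q x"
  by (simp add: qform_def trace_comb)

lemma mat_scale_in_Sym3: "X \<in> Sym3 \<Longrightarrow> mat_scale k X \<in> Sym3"
  by (simp add: Sym3_iff)

lemma add_in_Sym3: "X \<in> Sym3 \<Longrightarrow> Y \<in> Sym3 \<Longrightarrow> X + Y \<in> Sym3"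
  by (simp add: Sym3_iff)

text \<open>Comparing annihilators brings changes of coordinates and changes of basis of the pencil
  under one notion, so that they can be chained. Freeness from base points is carried forwards only,
  the direction in which normal forms are reached.\<close>

definition pencil_reduces ::
    "'a::{field,finite}^3^3 \<Rightarrow> 'a^3^3 \<Rightarrow> 'a^3^3 \<Rightarrow> 'a^3^3 \<Rightarrow> bool"
  where "pencil_reduces P Q P' Q' \<longleftrightarrow>
    code_equivalent (pencil_perp P Q) (pencil_perp P' Q') \<and> (base_free P Q \<longrightarrow> base_free P' Q')"

lemma pencil_reduces_base_free:
  "pencil_reduces P Q P' Q' \<Longrightarrow> base_free P Q \<Longrightarrow> base_free P' Q'"
  by (simp add: pencil_reduces_def)

lemma pencil_reduces_trans:
  "pencil_reduces P Q P' Q' \<Longrightarrow> pencil_reduces P' Q' P'' Q'' \<Longrightarrow> pencil_reduces P Q P'' Q''"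
  unfolding pencil_reduces_def using code_equivalent_trans by blast

text \<open>By \<open>trace_congruence\<close>, X \<mapsto> A X A^T carries the annihilator of the
  transformed pencil onto the original one: forms and matrices transform contragrediently.\<close>

lemma pencil_reduces_congruence:
  assumes "det A \<noteq> 0"
  shows "pencil_reduces P Q (transpose A ** P ** A) (transpose A ** Q ** A)"
proof -
  obtain B where B: "A ** B = mat 1" "B ** A = mat 1"
    using assms invertible_det_nz invertible_def by metis
  have BT: "transpose A ** transpose B = mat 1" "transpose B ** transpose A = mat 1"
    using B by (metis matrix_transpose_mul transpose_mat)+
  have inv: "invertible A" "invertible (transpose A)"
    using B BT invertible_def by blast+
  have id: "A ** (B ** X ** transpose B) ** transpose A = X" for X
    by (metis B(1) BT(2) matrix_mul_assoc matrix_mul_lid matrix_mul_rid)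
  have "pencil_perp P Q =
      {A ** X ** transpose A | X. X \<in> pencil_perp (transpose A ** P ** A) (transpose A ** Q ** A)}"
    (is "_ = {_ | X. X \<in> ?D}")
  proof (intro equalityI subsetI)
    fix X assume "X \<in> pencil_perp P Q"
    then have "B ** X ** transpose B \<in> ?D"
      by (simp add: pencil_perp_def trace_congruence id congruence_in_Sym3)
    then show "X \<in> {A ** X ** transpose A | X. X \<in> ?D}"
      using id[of X] by (metis (mono_tags, lifting) mem_Collect_eq)
  next
    fix X assume "X \<in> {A ** X ** transpose A | X. X \<in> ?D}"
    then show "X \<in> pencil_perp P Q"
      by (auto simp: pencil_perp_def trace_congruence congruence_in_Sym3)
  qed
  then have "code_equivalent ?D (pencil_perp P Q)"
    unfolding code_equivalent_def using inv by blast
  moreover have "base_free P Q \<longrightarrow> base_free (transpose A ** P ** A) (transpose A ** Q ** A)"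
    unfolding base_free_def qform_congruence
    by (metis B(2) matrix_vector_mul_assoc matrix_vector_mul_lid matrix_vector_mult_0_right)
  ultimately show ?thesis
    unfolding pencil_reduces_def using code_equivalent_sym by blast
qed

text \<open>Generators related by an invertible 2 by 2 matrix span the same pencil, so the
  annihilator is literally unchanged; \<open>iff\<close> is Cramer's rule.\<close>

lemma pencil_reduces_comb:
  assumes "a * d - b * c \<noteq> 0"
  shows "pencil_reduces P Q (mat_scale a P + mat_scale b Q) (mat_scale c P + mat_scale d Q)"
proof -
  have iff: "a * p + b * q = 0 \<and> c * p + d * q = 0 \<longleftrightarrow> p = 0 \<and> q = 0" for p q
  proof -
    have "(a * d - b * c) * p = d * (a * p + b * q) - b * (c * p + d * q)"
      "(a * d - b * c) * q = a * (c * p + d * q) - c * (a * p + b * q)"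
      by (simp_all add: algebra_simps)
    then show ?thesis
      using assms by auto
  qed
  have "pencil_perp (mat_scale a P + mat_scale b Q) (mat_scale c P + mat_scale d Q) = pencil_perp P Q"
    using iff by (simp add: pencil_perp_def trace_comb)
  moreover have "base_free P Q \<longrightarrow>
      base_free (mat_scale a P + mat_scale b Q) (mat_scale c P + mat_scale d Q)"
    unfolding base_free_def qform_comb by (metis iff)
  ultimately show ?thesis
    unfolding pencil_reduces_def using code_equivalent_refl by simp
qed

lemma pencil_reduces_cols:
  assumes "A = col_mat (vector [u1, u2, u3]) (vector [v1, v2, v3]) (vector [w1, w2, w3])"
    and "det A \<noteq> 0" "P' = transpose A ** P ** A" "Q' = transpose A ** Q ** A"
  shows "pencil_reduces P Q P' Q'"
  using pencil_reduces_congruence[OF assms(2)] assms(3,4) by simp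

text \<open>Positional instantiation follows the determinant and so reads \<open>a\<close>,
  \<open>d\<close>, \<open>b\<close>, \<open>c\<close>.\<close>

lemma pencil_reduces_combI:
  assumes "a * d - b * c \<noteq> 0"
    and "P' = mat_scale a P + mat_scale b Q" "Q' = mat_scale c P + mat_scale d Q"
  shows "pencil_reduces P Q P' Q'"
  using pencil_reduces_comb[OF assms(1)] assms(2,3) by simp

section \<open>Pencils with a reducible member\<close>

text \<open>The first generator is the double line x^2 = 0. On that line the other form must be
  anisotropic, which after completing squares makes it a multiple of y^2 - n z^2 modulo x^2, up to
  scaling z.\<close>

lemma double_line_normal_form:
  fixes n :: "'a::{field,finite}"
  assumes two: "(2::'a) \<noteq> 0" and n: "\<nexists>r. n = r\<^sup>2" and a: "a \<noteq> 0"
    and bf: "base_free (sym_mat a 0 0 0 0 0) (sym_mat a' b c d e f)"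
  shows "pencil_reduces (sym_mat a 0 0 0 0 0) (sym_mat a' b c d e f)
    (sym_mat 1 0 0 0 0 0) (sym_mat 0 1 (- n) 0 0 0)"
proof -
  have b: "b \<noteq> 0"
    using base_freeD_vector[OF bf, of 0 1 0] by auto
  obtain a1 c1 e1 where r1: "pencil_reduces (sym_mat a 0 0 0 0 0) (sym_mat a' b c d e f)
      (sym_mat a 0 0 0 0 0) (sym_mat a1 b c1 0 e1 0)"
  proof
    \<comment> \<open>Substituting y - (d/b) x - (f/b) z for y removes both mixed terms in
      y.\<close>
    show "pencil_reduces (sym_mat a 0 0 0 0 0) (sym_mat a' b c d e f)
      (sym_mat a 0 0 0 0 0) (sym_mat (a' - d\<^sup>2 / b) b (c - f\<^sup>2 / b) 0 (e - d * f / b) 0)"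
      by (rule pencil_reduces_cols[OF refl, of 1 "- d / b" 0 0 1 0 0 "- f / b" 1])
        (use b in \<open>simp_all add: congruence_sym_mat field_simps power2_eq_square\<close>)
  qed
  note bf1 = pencil_reduces_base_free[OF r1 bf]
  have c1: "c1 \<noteq> 0"
    using base_freeD_vector[OF bf1, of 0 0 1] by auto
  have r2: "pencil_reduces (sym_mat a 0 0 0 0 0) (sym_mat a1 b c1 0 e1 0)
      (sym_mat a 0 0 0 0 0) (sym_mat (a1 - e1\<^sup>2 / c1) b c1 0 0 0)"
    by (rule pencil_reduces_cols[OF refl, of 1 0 "- e1 / c1" 0 1 0 0 0 1])
      (use c1 in \<open>simp_all add: congruence_sym_mat field_simps power2_eq_square\<close>)
  \<comment> \<open>The x^2 term is a multiple of the first generator and is subtracted; then only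
    the ratio of the other two coefficients matters.\<close>
  define k where "k = c1 / b"
  have r3: "pencil_reduces (sym_mat a 0 0 0 0 0) (sym_mat (a1 - e1\<^sup>2 / c1) b c1 0 0 0)
      (sym_mat 1 0 0 0 0 0) (sym_mat 0 1 k 0 0 0)"
    by (rule pencil_reduces_combI[of "1 / a" "1 / b" 0 "- (a1 - e1\<^sup>2 / c1) / (a * b)"])
      (use a b in \<open>simp_all add: k_def field_simps\<close>)
  note r = pencil_reduces_trans[OF r1 pencil_reduces_trans[OF r2 r3]]
  note bf3 = pencil_reduces_base_free[OF r bf]
  have "\<nexists>r. - k = r\<^sup>2"
  proof
    assume "\<exists>r. - k = r\<^sup>2"
    then obtain r where "- k = r\<^sup>2" ..
    then have "r\<^sup>2 + k = 0"
      by (metis add.left_inverse add.commute)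
    then show False
      using base_freeD_vector[OF bf3, of 0 r 1] by auto
  qed
  then obtain s where s: "s \<noteq> 0" "- k = n * s\<^sup>2"
    using nonsquare_quotient_square[OF two n] by blast
  then have k: "k = - n * s\<^sup>2"
    by (metis minus_equation_iff minus_mult_left)
  have "pencil_reduces (sym_mat 1 0 0 0 0 0) (sym_mat 0 1 k 0 0 0)
      (sym_mat 1 0 0 0 0 0) (sym_mat 0 1 (- n) 0 0 0)"
    by (rule pencil_reduces_cols[OF refl, of 1 0 0 0 1 0 0 0 "1 / s"])
      (use s(1) k in \<open>simp_all add: congruence_sym_mat field_simps power2_eq_square\<close>)
  then show ?thesis
    using pencil_reduces_trans[OF r] by blast
qed

text \<open>With d \<noteq> 0 the first generator is x times a x + 2 d y + 2 e z, two different
  lines, which become x = 0 and y = 0. After completing squares in z, the absence of base points on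
  either line makes the coefficients of x^2 and y^2 equal to -n times squares.\<close>

lemma line_pair_normal_form:
  fixes n :: "'a::{field,finite}"
  assumes two: "(2::'a) \<noteq> 0" and n: "\<nexists>r. n = r\<^sup>2" and d: "d \<noteq> 0"
    and bf: "base_free (sym_mat a 0 0 d e 0) (sym_mat a' b' c' d' e' f')"
  shows "pencil_reduces (sym_mat a 0 0 d e 0) (sym_mat a' b' c' d' e' f')
    (sym_mat 0 0 0 1 0 0) (sym_mat (- n) (- n) 1 0 0 0)"
proof -
  have nonsq: "\<exists>s. s \<noteq> 0 \<and> k = - n * s\<^sup>2" if "\<And>r. k + r\<^sup>2 \<noteq> 0" for k
  proof -
    have "\<nexists>r. - k = r\<^sup>2"
      using that by (metis add.right_inverse)
    then obtain s where s: "s \<noteq> 0" "- k = n * s\<^sup>2"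
      using nonsquare_quotient_square[OF two n] by blast
    then show ?thesis
      by (metis minus_equation_iff minus_mult_left)
  qed
  obtain a1 b1 c1 d1 e1 f1 where r1: "pencil_reduces (sym_mat a 0 0 d e 0)
      (sym_mat a' b' c' d' e' f') (sym_mat 0 0 0 (1 / 2) 0 0) (sym_mat a1 b1 c1 d1 e1 f1)"
  proof -
    \<comment> \<open>The columns are chosen so that x stays and the factor a x + 2 d y + 2 e z
      becomes the new y; the entry 1/2 encodes the form x y.\<close>
    let ?A = "col_mat (vector [1, - a / (2 * d), 0]) (vector [0, 1 / (2 * d), 0]) (vector [0, - e / d, 1])"
    have "sym_mat 0 0 0 (1 / 2) 0 0 = transpose ?A ** sym_mat a 0 0 d e 0 ** ?A"
      using d two by (simp add: congruence_sym_mat field_simps)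
    moreover have "det ?A \<noteq> 0"
      using d two by simp
    ultimately have "pencil_reduces (sym_mat a 0 0 d e 0) (sym_mat a' b' c' d' e' f')
        (sym_mat 0 0 0 (1 / 2) 0 0) (transpose ?A ** sym_mat a' b' c' d' e' f' ** ?A)"
      using pencil_reduces_congruence by metis
    then show ?thesis
      using that by (auto simp: congruence_sym_mat)
  qed
  note bf1 = pencil_reduces_base_free[OF r1 bf]
  have c1: "c1 \<noteq> 0"
    using base_freeD_vector[OF bf1, of 0 0 1] by auto
  obtain a2 b2 d2 where r2: "pencil_reduces (sym_mat 0 0 0 (1 / 2) 0 0) (sym_mat a1 b1 c1 d1 e1 f1)
      (sym_mat 0 0 0 (1 / 2) 0 0) (sym_mat a2 b2 c1 d2 0 0)"
  proof
    show "pencil_reduces (sym_mat 0 0 0 (1 / 2) 0 0) (sym_mat a1 b1 c1 d1 e1 f1)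
      (sym_mat 0 0 0 (1 / 2) 0 0)
      (sym_mat (a1 - e1\<^sup>2 / c1) (b1 - f1\<^sup>2 / c1) c1 (d1 - e1 * f1 / c1) 0 0)"
      by (rule pencil_reduces_cols[OF refl, of 1 0 "- e1 / c1" 0 1 "- f1 / c1" 0 0 1])
        (use c1 two in \<open>simp_all add: congruence_sym_mat field_simps power2_eq_square\<close>)
  qed
  obtain a3 b3 where r3: "pencil_reduces (sym_mat 0 0 0 (1 / 2) 0 0) (sym_mat a2 b2 c1 d2 0 0)
      (sym_mat 0 0 0 1 0 0) (sym_mat a3 b3 1 0 0 0)"
  proof
    show "pencil_reduces (sym_mat 0 0 0 (1 / 2) 0 0) (sym_mat a2 b2 c1 d2 0 0)
      (sym_mat 0 0 0 1 0 0) (sym_mat (a2 / c1) (b2 / c1) 1 0 0 0)"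
      by (rule pencil_reduces_combI[of 2 "1 / c1" 0 "- 2 * d2 / c1"])
        (use c1 two in \<open>simp_all add: field_simps\<close>)
  qed
  note r = pencil_reduces_trans[OF r1 pencil_reduces_trans[OF r2 r3]]
  note bf3 = pencil_reduces_base_free[OF r bf]
  \<comment> \<open>(1, 0, r) and (0, 1, r) lie on the line pair, so neither may be a zero of the
    second form.\<close>
  have "a3 + r\<^sup>2 \<noteq> 0" "b3 + r\<^sup>2 \<noteq> 0" for r
    using base_freeD_vector[OF bf3, of 1 0 r] base_freeD_vector[OF bf3, of 0 1 r] by auto
  then obtain s t where s: "s \<noteq> 0" "a3 = - n * s\<^sup>2" and t: "t \<noteq> 0" "b3 = - n * t\<^sup>2"
    using nonsq by metis
  have r4: "pencil_reduces (sym_mat 0 0 0 1 0 0) (sym_mat a3 b3 1 0 0 0)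
      (sym_mat 0 0 0 (1 / (s * t)) 0 0) (sym_mat (- n) (- n) 1 0 0 0)"
    by (rule pencil_reduces_cols[OF refl, of "1 / s" 0 0 0 "1 / t" 0 0 0 1])
      (use s t in \<open>simp_all add: congruence_sym_mat field_simps power2_eq_square\<close>)
  have r5: "pencil_reduces (sym_mat 0 0 0 (1 / (s * t)) 0 0) (sym_mat (- n) (- n) 1 0 0 0)
      (sym_mat 0 0 0 1 0 0) (sym_mat (- n) (- n) 1 0 0 0)"
    by (rule pencil_reduces_combI[of "s * t" 1 0 0]) (use s t in simp_all)
  show ?thesis
    using pencil_reduces_trans[OF r pencil_reduces_trans[OF r4 r5]] .
qed

definition double_line_code :: "'a::{field,finite} \<Rightarrow> ('a^3^3) set"
  where "double_line_code n = pencil_perp (sym_mat 1 0 0 0 0 0) (sym_mat 0 1 (- n) 0 0 0)"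

definition line_pair_code :: "'a::{field,finite} \<Rightarrow> ('a^3^3) set"
  where "line_pair_code n = pencil_perp (sym_mat 0 0 0 1 0 0) (sym_mat (- n) (- n) 1 0 0 0)"

text \<open>For nonsquare n and \<theta> = b + 2 d \<surd>n, the intended parameters are those for
  which the norm b^2 - 4 n d^2 of \<theta> is a nonsquare; when it is a square, the pencil also
  contains a pair of lines.\<close>

definition no_line_code :: "'a::{field,finite} \<Rightarrow> 'a \<Rightarrow> 'a \<Rightarrow> ('a^3^3) set"
  where "no_line_code n b d = pencil_perp (sym_mat 1 (- n) 0 0 0 0) (sym_mat 0 b 1 d 0 0)"

text \<open>The first generator, x (a x + 2 d y + 2 e z), is the general conic containing the line x
  = 0. Exchanging y and z reduces d = 0, e \<noteq> 0 to d \<noteq> 0.\<close>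

lemma reducible_member_classification:
  fixes n :: "'a::{field,finite}"
  assumes two: "(2::'a) \<noteq> 0" and n: "\<nexists>r. n = r\<^sup>2"
    and P: "a \<noteq> 0 \<or> d \<noteq> 0 \<or> e \<noteq> 0" and Q: "Q \<in> Sym3"
    and bf: "base_free (sym_mat a 0 0 d e 0) Q"
  shows "code_equivalent (pencil_perp (sym_mat a 0 0 d e 0) Q) (double_line_code n) \<or>
    code_equivalent (pencil_perp (sym_mat a 0 0 d e 0) Q) (line_pair_code n)"
proof -
  obtain a' b' c' d' e' f' where Q': "Q = sym_mat a' b' c' d' e' f'"
    using Q by (rule Sym3E)
  note bf' = bf[unfolded Q']
  consider "d = 0" "e = 0" "a \<noteq> 0" | "d \<noteq> 0" | "d = 0" "e \<noteq> 0"
    using P by blast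
  then show ?thesis
  proof cases
    case 1
    then show ?thesis
      using double_line_normal_form[OF two n] bf'
      by (simp add: Q' double_line_code_def pencil_reduces_def)
  next
    case 2
    then show ?thesis
      using line_pair_normal_form[OF two n 2 bf']
      by (simp add: Q' line_pair_code_def pencil_reduces_def)
  next
    case 3
    have r: "pencil_reduces (sym_mat a 0 0 d e 0) (sym_mat a' b' c' d' e' f')
        (sym_mat a 0 0 e d 0) (sym_mat a' c' b' e' d' f')"
      by (rule pencil_reduces_cols[OF refl, of 1 0 0 0 0 1 0 1 0])
        (simp_all add: congruence_sym_mat)
    have "pencil_reduces (sym_mat a 0 0 e d 0) (sym_mat a' c' b' e' d' f')
        (sym_mat 0 0 0 1 0 0) (sym_mat (- n) (- n) 1 0 0 0)"
      using line_pair_normal_form[OF two n 3(2)] pencil_reduces_base_free[OF r bf'] by blast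
    then show ?thesis
      using pencil_reduces_trans[OF r]
      by (simp add: Q' line_pair_code_def pencil_reduces_def)
  qed
qed

section \<open>Zeros of ternary quadratic forms\<close>

text \<open>Unless a zero with z = 0 is visible at once, z is set to 1 and squares are completed
  twice; \<open>diagonal_binary_form_universal\<close> solves the resulting equation in two
  squares.\<close>

lemma ternary_form_isotropic:
  fixes P :: "'a::{field,finite}^3^3"
  assumes two: "(2::'a) \<noteq> 0" and "P \<in> Sym3"
  obtains x where "x \<noteq> 0" "qform P x = 0"
proof -
  obtain a b c d e f where P: "P = sym_mat a b c d e f"
    using assms(2) by (rule Sym3E)
  define B where "B = a * b - d\<^sup>2"
  define F where "F = a * f - d * e"
  define C where "C = a * c - e\<^sup>2"
  consider "a = 0" | "a \<noteq> 0" "B = 0" | "a \<noteq> 0" "B \<noteq> 0"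
    by blast
  then show ?thesis
  proof cases
    case 1
    then show ?thesis
      using that[of "vector [1, 0, 0]"] by (simp add: P)
  next
    case 2
    have "qform P (vector [- d / a, 1, 0]) = B / a"
      using 2(1) by (simp add: P B_def field_simps power2_eq_square)
    then show ?thesis
      using that[of "vector [- d / a, 1, 0]"] 2 by simp
  next
    case 3
    obtain X Y where XY: "B * X\<^sup>2 + 1 * Y\<^sup>2 = F\<^sup>2 - B * C"
      using diagonal_binary_form_universal[OF two 3(2), of 1 "F\<^sup>2 - B * C"] by auto
    \<comment> \<open>x and y are recovered from the completed squares X = a x + d y + e and Y = B y
      + F.\<close>
    define y where "y = (Y - F) / B"
    define x where "x = (X - d * y - e) / a"
    have y: "B * y + F = Y" and x: "a * x + d * y + e = X"
      using 3 by (simp_all add: x_def y_def)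
    have "a * B * qform P (vector [x, y, 1]) =
        B * (a * x + d * y + e)\<^sup>2 + ((B * y + F)\<^sup>2 + (B * C - F\<^sup>2))"
    proof -
      have "a * qform P (vector [x, y, 1]) =
          (a * x + d * y + e)\<^sup>2 + (B * y\<^sup>2 + 2 * F * y + C)"
        by (simp add: P B_def C_def F_def algebra_simps power2_eq_square)
      then have "B * (a * qform P (vector [x, y, 1])) =
          B * (a * x + d * y + e)\<^sup>2 + B * (B * y\<^sup>2 + 2 * F * y + C)"
        by (simp only: distrib_left)
      also have "B * (B * y\<^sup>2 + 2 * F * y + C) = (B * y + F)\<^sup>2 + (B * C - F\<^sup>2)"
        by (simp add: algebra_simps power2_eq_square)
      finally show ?thesis
        by (simp only: ac_simps)
    qed
    also have "\<dots> = 0"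
      using XY by (simp add: x y flip: add.assoc)
    finally have "qform P (vector [x, y, 1]) = 0"
      using 3 by simp
    then show ?thesis
      using that[of "vector [x, y, 1]"] by simp
  qed
qed

text \<open>With v as last column the matrix sends (0, 0, 1) to v, so that facts about v turn into
  vanishing entries in the last row and column of a congruent matrix.\<close>

lemma extend_to_col_mat:
  assumes "(v :: 'a::field^3) \<noteq> 0"
  obtains u1 u2 u3 w1 w2 w3 v1 v2 v3 where "v = vector [v1, v2, v3]"
    "det (col_mat (vector [u1, u2, u3]) (vector [w1, w2, w3]) (vector [v1, v2, v3])) \<noteq> 0"
proof -
  obtain v1 v2 v3 where v: "v = vector [v1, v2, v3]"
    by (rule vector3_cases)
  consider "v1 \<noteq> 0" | "v2 \<noteq> 0" | "v3 \<noteq> 0"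
    using assms v by auto
  then show ?thesis
  proof cases
    case 1
    then show ?thesis using that[of v1 v2 v3 0 1 0 0 0 1] v by simp
  next
    case 2
    then show ?thesis using that[of v1 v2 v3 1 0 0 0 0 1] v by simp
  next
    case 3
    then show ?thesis using that[of v1 v2 v3 1 0 0 0 1 0] v by simp
  qed
qed

lemma card_zeros_congruence:
  fixes P :: "'a::{field,finite}^3^3"
  assumes "det A \<noteq> 0"
  shows "card {x. qform (transpose A ** P ** A) x = 0} = card {x. qform P x = 0}"
proof (rule bij_betw_same_card)
  obtain B where B: "A ** B = mat 1" "B ** A = mat 1"
    using assms invertible_det_nz invertible_def by metis
  have "A *v (B *v x) = x" "B *v (A *v x) = x" for x
    by (simp_all add: matrix_vector_mul_assoc B)
  then show "bij_betw ((*v) A) {x. qform (transpose A ** P ** A) x = 0} {x. qform P x = 0}"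
    by (intro bij_betw_byWitness[of _ "(*v) B"]) (auto simp: qform_congruence)
qed

lemma det_congruence_neq_0:
  fixes P :: "'a::field^3^3"
  shows "det A \<noteq> 0 \<Longrightarrow> det P \<noteq> 0 \<Longrightarrow> det (transpose A ** P ** A) \<noteq> 0"
  by (simp add: det_mul)

text \<open>If x \<noteq> 0, the equation is linear in z with one solution for each of the (q - 1) q
  pairs (x, y). If x = 0, then y = 0 and z is free.\<close>

lemma card_zeros_normal_form:
  fixes a :: "'a::{field,finite}"
  assumes two: "(2::'a) \<noteq> 0" and b: "b \<noteq> 0" and e: "e \<noteq> 0"
  shows "card {x. qform (sym_mat a b 0 d e 0) x = 0} = CARD('a)\<^sup>2"
proof -
  let ?Z = "{x. qform (sym_mat a b 0 d e 0) x = 0}"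
  let ?f = "\<lambda>(x, y). vector [x, y, - (a * x\<^sup>2 + b * y\<^sup>2 + 2 * d * x * y) / (2 * e * x)] :: 'a^3"
  let ?g = "\<lambda>z. vector [0, 0, z] :: 'a^3"
  have Z: "?Z = ?f ` ((- {0}) \<times> UNIV) \<union> range ?g"
  proof (intro equalityI subsetI)
    fix v assume v: "v \<in> ?Z"
    obtain x y z where xyz: "v = vector [x, y, z]"
      by (rule vector3_cases)
    have eq: "a * x\<^sup>2 + b * y\<^sup>2 + 2 * (d * (x * y) + e * (x * z)) = 0"
      using v by (simp add: xyz)
    show "v \<in> ?f ` ((- {0}) \<times> UNIV) \<union> range ?g"
    proof (cases "x = 0")
      case True
      then show ?thesis
        using eq b by (auto simp: xyz)
    next
      case False
      have "z * (2 * e * x) = - (a * x\<^sup>2 + b * y\<^sup>2 + 2 * d * x * y)"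
        using eq by (simp add: algebra_simps eq_neg_iff_add_eq_0)
      then have "v = ?f (x, y)"
        using False e two by (simp add: xyz eq_divide_eq)
      then show ?thesis
        using False by blast
    qed
  next
    fix v assume "v \<in> ?f ` ((- {0}) \<times> UNIV) \<union> range ?g"
    then show "v \<in> ?Z"
    proof
      assume "v \<in> ?f ` ((- {0}) \<times> UNIV)"
      then obtain x y where x: "x \<noteq> 0" and v: "v = ?f (x, y)"
        by auto
      define z where "z = - (a * x\<^sup>2 + b * y\<^sup>2 + 2 * d * x * y) / (2 * e * x)"
      have "z * (2 * e * x) = - (a * x\<^sup>2 + b * y\<^sup>2 + 2 * d * x * y)"
        using x e two by (simp add: z_def)
      then have "a * x\<^sup>2 + b * y\<^sup>2 + 2 * (d * (x * y) + e * (x * z)) = 0"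
        by (simp add: algebra_simps eq_neg_iff_add_eq_0)
      then show ?thesis
        using v by (simp add: z_def)
    qed auto
  qed
  have "card (?f ` ((- {0}) \<times> UNIV)) = (CARD('a) - 1) * CARD('a)"
    by (subst card_image) (auto simp: inj_on_def card_cartesian_product Compl_eq_Diff_UNIV)
  moreover have "card (range ?g) = CARD('a)"
    by (rule card_image) (auto simp: inj_on_def)
  moreover have "?f ` ((- {0}) \<times> UNIV) \<inter> range ?g = {}"
    by auto
  ultimately have "card ?Z = (CARD('a) - 1) * CARD('a) + CARD('a)"
    unfolding Z by (subst card_Un_disjoint) simp_all
  also have "\<dots> = CARD('a)\<^sup>2"
    using CARD_field_ge_2[where 'a='a] by (simp add: algebra_simps power2_eq_square)
  finally show ?thesis .
qed

text \<open>Moving a nontrivial zero to (0, 0, 1) kills the coefficient of z^2. Nonsingularity then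
  leaves x z or y z with a nonzero coefficient, and the form can be brought to the shape of
  \<open>card_zeros_normal_form\<close>.\<close>

lemma card_zeros_nondegenerate:
  fixes P :: "'a::{field,finite}^3^3"
  assumes two: "(2::'a) \<noteq> 0" and P: "P \<in> Sym3" and "det P \<noteq> 0"
  shows "card {x. qform P x = 0} = CARD('a)\<^sup>2"
proof -
  have e_case: "card {x. qform (sym_mat a b 0 d e f) x = 0} = CARD('a)\<^sup>2"
    if e: "e \<noteq> 0" and det: "det (sym_mat a b 0 d e f) \<noteq> 0" for a b d e f :: 'a
  proof -
    \<comment> \<open>Replacing x by x - (f/e) y removes the y z term; the determinant is then -b'
      e^2, whence b' \<noteq> 0.\<close>
    let ?A = "col_mat (vector [1, 0, 0]) (vector [- f / e, 1, 0]) (vector [0, 0, 1])"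
    obtain a' b' d' where eq:
      "transpose ?A ** sym_mat a b 0 d e f ** ?A = sym_mat a' b' 0 d' e 0"
      using e by (simp add: congruence_sym_mat)
    have "det (sym_mat a' b' 0 d' e 0) \<noteq> 0"
      unfolding eq[symmetric] by (rule det_congruence_neq_0[OF _ det]) simp
    then have "b' \<noteq> 0"
      by (auto simp: det_sym_mat)
    then have "card {x. qform (sym_mat a' b' 0 d' e 0) x = 0} = CARD('a)\<^sup>2"
      using card_zeros_normal_form[OF two] e by blast
    then show ?thesis
      using card_zeros_congruence[of ?A "sym_mat a b 0 d e f", unfolded eq] by simp
  qed
  obtain v where v: "v \<noteq> 0" "qform P v = 0"
    using ternary_form_isotropic[OF two P] .
  obtain u1 u2 u3 w1 w2 w3 v1 v2 v3 where vv: "v = vector [v1, v2, v3]" and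
    det: "det (col_mat (vector [u1, u2, u3]) (vector [w1, w2, w3]) (vector [v1, v2, v3])) \<noteq> 0"
    (is "det ?A \<noteq> 0")
    using extend_to_col_mat[OF v(1)] .
  obtain a b c d e f where P': "P = sym_mat a b c d e f"
    using P by (rule Sym3E)
  obtain a' b' c' d' e' f' where eq: "transpose ?A ** P ** ?A = sym_mat a' b' c' d' e' f'"
    by (simp add: P' congruence_sym_mat)
  have "?A *v vector [0, 0, 1] = v"
    by (simp add: vv col_mat_def vec_eq_iff forall_3 matrix_vector_mult_def sum_3 transpose_def)
  then have "c' = 0"
    using qform_congruence[of ?A P "vector [0, 0, 1]"] v(2) by (simp add: eq)
  have card: "card {x. qform P x = 0} = card {x. qform (sym_mat a' b' 0 d' e' f') x = 0}"
    using card_zeros_congruence[OF det, of P] by (simp add: eq \<open>c' = 0\<close>)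
  have det': "det (sym_mat a' b' 0 d' e' f') \<noteq> 0"
    using det_congruence_neq_0[OF det assms(3)] by (simp add: eq \<open>c' = 0\<close>)
  show ?thesis
  proof (cases "e' = 0")
    case False
    then show ?thesis
      using e_case[OF False det'] card by simp
  next
    case True
    then have "f' \<noteq> 0"
      using det' by (auto simp: det_sym_mat)
    \<comment> \<open>Exchanging x and y puts f' in the place of e'.\<close>
    let ?B = "col_mat (vector [0, 1, 0]) (vector [1, 0, 0]) (vector [0, 0, 1]) :: 'a^3^3"
    have eq2: "transpose ?B ** sym_mat a' b' 0 d' e' f' ** ?B = sym_mat b' a' 0 d' f' e'"
      by (simp add: congruence_sym_mat)
    have detB: "det ?B \<noteq> 0"
      by simp
    have "det (sym_mat b' a' 0 d' f' e') \<noteq> 0"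
      using det_congruence_neq_0[OF detB det'] by (simp only: eq2 not_False_eq_True)
    then show ?thesis
      using e_case[OF \<open>f' \<noteq> 0\<close>] card card_zeros_congruence[OF detB, of "sym_mat a' b' 0 d' e' f'"]
      by (simp add: eq2)
  qed
qed

text \<open>The kernel of a nonzero functional on the plane is the line through (q, -p).\<close>

lemma card_line_through_origin:
  fixes p q :: "'a::{field,finite}"
  assumes "p \<noteq> 0 \<or> q \<noteq> 0"
  shows "card {(s, t). s * p + t * q = 0} = CARD('a)"
proof -
  have "{(s, t). s * p + t * q = 0} = range (\<lambda>k. (k * q, - k * p))"
  proof (intro equalityI subsetI)
    fix st assume "st \<in> {(s, t). s * p + t * q = 0}"
    then obtain s t where st: "st = (s, t)" "s * p + t * q = 0"
      by auto
    then have "s * p = - (t * q)"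
      by (simp add: eq_neg_iff_add_eq_0)
    then have "st = ((s / q) * q, - (s / q) * p) \<or> st = ((- t / p) * q, - (- t / p) * p)"
      using assms by (cases "q = 0") (auto simp: st(1) field_simps)
    then show "st \<in> range (\<lambda>k. (k * q, - k * p))"
      by blast
  qed auto
  moreover have "inj (\<lambda>k. (k * q, - k * p))"
    using assms by (auto simp: inj_on_def)
  ultimately show ?thesis
    by (simp add: card_image)
qed

text \<open>
  Otherwise each of the \<open>q\<^sup>2 - 1\<close> nontrivial members has \<open>q\<^sup>2\<close> zeros, whereas every nonzero
  vector is a zero of exactly \<open>q\<close> members; double counting gives \<open>(q - 1)\<^sup>2 = 0\<close>.
\<close>

lemma base_free_pencil_degenerate_member:
  fixes P Q :: "'a::{field,finite}^3^3"
  assumes two: "(2::'a) \<noteq> 0" and P: "P \<in> Sym3" and Q: "Q \<in> Sym3" and bf: "base_free P Q"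
  obtains s t where "s \<noteq> 0 \<or> t \<noteq> 0" "det (mat_scale s P + mat_scale t Q) = 0"
proof (rule ccontr)
  assume "\<not> thesis"
  then have nd: "det (mat_scale s P + mat_scale t Q) \<noteq> 0" if "s \<noteq> 0 \<or> t \<noteq> 0" for s t
    using that \<open>\<And>s t. \<lbrakk>s \<noteq> 0 \<or> t \<noteq> 0; det (mat_scale s P + mat_scale t Q) = 0\<rbrakk> \<Longrightarrow> thesis\<close> by blast
  let ?q = "CARD('a)"
  let ?Z = "\<lambda>(s, t). {x. s * qform P x + t * qform Q x = 0}"
  have cardF3: "CARD('a^3) = ?q ^ 3"
    by simp
  have cZ: "card (?Z st) = ?q\<^sup>2" if "st \<in> UNIV - {(0, 0)}" for st
  proof -
    obtain s t where st: "st = (s, t)" "s \<noteq> 0 \<or> t \<noteq> 0"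
      using \<open>st \<in> UNIV - {(0, 0)}\<close> by (cases st) auto
    have "mat_scale s P + mat_scale t Q \<in> Sym3"
      using P Q by (intro add_in_Sym3 mat_scale_in_Sym3)
    then have "card {x. qform (mat_scale s P + mat_scale t Q) x = 0} = ?q\<^sup>2"
      using card_zeros_nondegenerate[OF two] nd[OF st(2)] by blast
    then show ?thesis
      by (simp add: st(1) qform_comb)
  qed
  have "card (SIGMA st:UNIV. ?Z st) = (\<Sum>st\<in>UNIV. card (?Z st))"
    by (rule card_SigmaI) auto
  \<comment> \<open>The trivial member vanishes on all q^3 vectors and is split off; the zero vector
    is treated likewise in the other count.\<close>
  also have "\<dots> = card (?Z (0, 0)) + (\<Sum>st\<in>UNIV - {(0, 0)}. card (?Z st))"
    by (rule sum.remove) auto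
  also have "\<dots> = ?q ^ 3 + (?q\<^sup>2 - 1) * ?q\<^sup>2"
    using cZ cardF3 by (simp add: card_Diff_singleton power2_eq_square)
  finally have 1: "card (SIGMA st:UNIV. ?Z st) = ?q ^ 3 + (?q\<^sup>2 - 1) * ?q\<^sup>2" .
  let ?L = "\<lambda>x. {(s, t). s * qform P x + t * qform Q x = 0}"
  have cL: "card (?L x) = ?q" if "x \<in> UNIV - {0}" for x
    by (rule card_line_through_origin) (use bf that in \<open>auto simp: base_free_def\<close>)
  have "bij_betw prod.swap (SIGMA st:UNIV. ?Z st) (SIGMA x:UNIV. ?L x)"
    by (rule bij_betw_byWitness[of _ prod.swap]) auto
  then have "card (SIGMA st:UNIV. ?Z st) = card (SIGMA x:UNIV. ?L x)"
    by (rule bij_betw_same_card)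
  also have "\<dots> = (\<Sum>x\<in>UNIV. card (?L x))"
    by (rule card_SigmaI) auto
  also have "\<dots> = card (?L 0) + (\<Sum>x\<in>UNIV - {0}. card (?L x))"
    by (rule sum.remove) auto
  also have "card (?L 0) = ?q\<^sup>2"
  proof -
    have "qform P 0 = 0" "qform Q 0 = 0"
      by (simp_all add: qform_def outer_def trace_def matrix_matrix_mult_def)
    then show ?thesis
      by (simp add: power2_eq_square)
  qed
  also have "(\<Sum>x\<in>UNIV - {0}. card (?L x)) = (?q ^ 3 - 1) * ?q"
    using cL cardF3 by (simp add: card_Diff_singleton)
  finally have "?q ^ 3 + (?q\<^sup>2 - 1) * ?q\<^sup>2 = ?q\<^sup>2 + (?q ^ 3 - 1) * ?q"
    using 1 by simp
  \<comment> \<open>Over the integers, free of truncated subtraction, the two counts differ by q (q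
    - 1)^2.\<close>
  then have "int (?q ^ 3 + (?q\<^sup>2 - 1) * ?q\<^sup>2) = int (?q\<^sup>2 + (?q ^ 3 - 1) * ?q)"
    by simp
  moreover have "1 \<le> ?q\<^sup>2" "1 \<le> ?q ^ 3"
    by (simp_all add: Suc_le_eq)
  ultimately have "int ?q ^ 3 + (int ?q ^ 2 - 1) * int ?q ^ 2 = int ?q ^ 2 + (int ?q ^ 3 - 1) * int ?q"
    by (simp add: of_nat_diff)
  then have "int ?q * (int ?q - 1)\<^sup>2 = 0"
    by (simp add: algebra_simps power2_eq_square power3_eq_cube)
  then show False
    using CARD_field_ge_2[where 'a='a] by simp
qed

section \<open>Classification of pencils without base points\<close>

definition classified :: "'a::{field,finite} \<Rightarrow> 'a \<Rightarrow> 'a \<Rightarrow> ('a^3^3) set \<Rightarrow> bool"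
  where "classified n b d C \<longleftrightarrow> code_equivalent C (no_line_code n b d) \<or>
    code_equivalent C (double_line_code n) \<or> code_equivalent C (line_pair_code n)"

lemma classified_reduces:
  assumes "pencil_reduces P Q P' Q'" "classified n b d (pencil_perp P' Q')"
  shows "classified n b d (pencil_perp P Q)"
  using assms code_equivalent_trans unfolding classified_def pencil_reduces_def by metis

lemma classified_reducible_member:
  fixes n :: "'a::{field,finite}"
  assumes "(2::'a) \<noteq> 0" "\<nexists>r. n = r\<^sup>2" "a \<noteq> 0 \<or> d \<noteq> 0 \<or> e \<noteq> 0" "Q \<in> Sym3"
    and "base_free (sym_mat a 0 0 d e 0) Q"
  shows "classified n b0 d0 (pencil_perp (sym_mat a 0 0 d e 0) Q)"
  using reducible_member_classification[OF assms] unfolding classified_def by blast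

text \<open>
  Writing \<open>\<theta> = b + 2d\<surd>n\<close>, multiplying \<open>x + y\<surd>n\<close> by \<open>\<mu>\<close> multiplies \<open>\<theta>\<close> by \<open>\<mu>\<^sup>2\<close>. If the norm
  of \<open>\<theta>\<close> is a square then so is \<open>-\<theta>\<close>, which yields a member of the pencil that splits into two
  lines; otherwise \<open>\<theta>/\<theta>\<^sub>0\<close> is a square.
\<close>

lemma classified_anisotropic_member:
  fixes n b0 d0 :: "'a::{field,finite}"
  assumes two: "(2::'a) \<noteq> 0" and n: "\<nexists>r. n = r\<^sup>2" and N0: "\<nexists>r. b0\<^sup>2 - 4 * n * d0\<^sup>2 = r\<^sup>2"
    and bf: "base_free (sym_mat 1 (- n) 0 0 0 0) (sym_mat 0 b 1 d 0 0)"
  shows "classified n b0 d0 (pencil_perp (sym_mat 1 (- n) 0 0 0 0) (sym_mat 0 b 1 d 0 0))"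
proof (cases "\<exists>w. b\<^sup>2 - 4 * n * d\<^sup>2 = w\<^sup>2")
  case True
  then obtain w where "(- b)\<^sup>2 - 4 * n * (- d)\<^sup>2 = w\<^sup>2"
    by auto
  then obtain u v where "v\<^sup>2 + n * u\<^sup>2 = - b" "u * v = - d"
    using square_norm_imp_square[OF two n] by metis
  then have b: "b = - (v\<^sup>2 + n * u\<^sup>2)" and d: "d = - (u * v)"
    by simp_all
  \<comment> \<open>The second generator minus u^2 times the first is now z^2 - (u x + v y)^2, a
    pair of lines.\<close>
  have r1: "pencil_reduces (sym_mat 1 (- n) 0 0 0 0) (sym_mat 0 b 1 d 0 0)
      (sym_mat (- u\<^sup>2) (- v\<^sup>2) 1 (- (u * v)) 0 0) (sym_mat 1 (- n) 0 0 0 0)"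
    by (rule pencil_reduces_combI[of "- u\<^sup>2" 0 1 1])
      (simp_all add: b d)
  obtain Q where Q: "Q \<in> Sym3" and r2: "pencil_reduces
      (sym_mat (- u\<^sup>2) (- v\<^sup>2) 1 (- (u * v)) 0 0) (sym_mat 1 (- n) 0 0 0 0) (sym_mat 1 0 0 u v 0) Q"
  proof
    \<comment> \<open>The factor z - u x - v y becomes the new x.\<close>
    let ?A = "col_mat (vector [0, 0, 1]) (vector [1, 0, u]) (vector [0, 1, v])"
    show "transpose ?A ** sym_mat 1 (- n) 0 0 0 0 ** ?A \<in> Sym3"
      by (simp add: congruence_in_Sym3')
    show "pencil_reduces (sym_mat (- u\<^sup>2) (- v\<^sup>2) 1 (- (u * v)) 0 0) (sym_mat 1 (- n) 0 0 0 0)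
        (sym_mat 1 0 0 u v 0) (transpose ?A ** sym_mat 1 (- n) 0 0 0 0 ** ?A)"
      by (rule pencil_reduces_cols[OF refl, of 0 0 1 1 0 u 0 1 v])
        (simp_all add: congruence_sym_mat power2_eq_square)
  qed
  note r = pencil_reduces_trans[OF r1 r2]
  show ?thesis
    by (rule classified_reduces[OF r], rule classified_reducible_member[OF two n _ Q])
      (simp_all add: pencil_reduces_base_free[OF r bf])
next
  case False
  define N where "N = b0\<^sup>2 - 4 * n * d0\<^sup>2"
  have N: "N \<noteq> 0"
    using N0 unfolding N_def by (metis power_zero_numeral)
  obtain w where w: "b\<^sup>2 - 4 * n * d\<^sup>2 = N * w\<^sup>2"
    using nonsquare_quotient_square[OF two N0] False unfolding N_def by metis
  \<comment> \<open>p + 2 r \<surd>n is the quotient \<open>\<theta>/\<theta>\<^sub>0\<close> with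
    \<open>\<theta>\<^sub>0 = b0 + 2 d0 \<surd>n\<close>, computed by multiplying with the conjugate
    of the denominator. Its norm is w^2.\<close>
  define p where "p = (b * b0 - 4 * n * d * d0) / N"
  define r where "r = (d * b0 - b * d0) / N"
  have Np: "N * p = b * b0 - 4 * n * d * d0" and Nr: "N * r = d * b0 - b * d0"
    using N by (simp_all add: p_def r_def)
  have "N * (b0 * p + 4 * n * d0 * r) = N * b"
  proof -
    have "N * (b0 * p + 4 * n * d0 * r) = b0 * (N * p) + 4 * n * d0 * (N * r)"
      by (simp add: algebra_simps)
    also have "\<dots> = N * b"
      unfolding Np Nr by (simp add: N_def algebra_simps power2_eq_square)
    finally show ?thesis .
  qed
  then have b: "b = b0 * p + 4 * n * d0 * r"
    using N by simp
  have "N * (b0 * r + d0 * p) = N * d"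
  proof -
    have "N * (b0 * r + d0 * p) = b0 * (N * r) + d0 * (N * p)"
      by (simp add: algebra_simps)
    also have "\<dots> = N * d"
      unfolding Np Nr by (simp add: N_def algebra_simps power2_eq_square)
    finally show ?thesis .
  qed
  then have d: "d = b0 * r + d0 * p"
    using N by simp
  have "N * (p\<^sup>2 - 4 * n * r\<^sup>2) = N * w\<^sup>2"
    unfolding w[symmetric] b d by (simp add: N_def algebra_simps power2_eq_square)
  then have "p\<^sup>2 - 4 * n * r\<^sup>2 = w\<^sup>2"
    using N by simp
  then obtain u v where p: "p = v\<^sup>2 + n * u\<^sup>2" and r: "r = u * v"
    using square_norm_imp_square[OF two n] by metis
  \<comment> \<open>v + u \<surd>n is a square root of that quotient, and this is its norm. Were it
    0, \<theta> would vanish and its norm would be a square.\<close>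
  have M: "v\<^sup>2 - n * u\<^sup>2 \<noteq> 0"
  proof
    assume "v\<^sup>2 - n * u\<^sup>2 = 0"
    then have v: "v\<^sup>2 = n * u\<^sup>2"
      by simp
    have "u = 0"
    proof (rule ccontr)
      assume "u \<noteq> 0"
      then have "n = (v / u)\<^sup>2"
        using v by (simp add: field_simps)
      then show False
        using n by blast
    qed
    then have "b = 0 \<and> d = 0"
      using v by (simp add: b d p r)
    then show False
      using False by auto
  qed
  let ?a = "b0 * u\<^sup>2 + 2 * d0 * u * v"
  \<comment> \<open>The substitution multiplies x + y \<surd>n by v + u \<surd>n and so scales the
    first form by the norm of the latter; the x^2 term created in the second form is removed in
    \<open>r2\<close>.\<close>
  have r1: "pencil_reduces (sym_mat 1 (- n) 0 0 0 0) (sym_mat 0 b0 1 d0 0 0)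
      (sym_mat (v\<^sup>2 - n * u\<^sup>2) (- n * (v\<^sup>2 - n * u\<^sup>2)) 0 0 0 0)
      (sym_mat ?a (b - n * ?a) 1 d 0 0)"
    by (rule pencil_reduces_cols[OF refl, of v u 0 "n * u" v 0 0 0 1])
      (use M in \<open>simp_all add: congruence_sym_mat b d p r algebra_simps power2_eq_square\<close>)
  have r2: "pencil_reduces
      (sym_mat (v\<^sup>2 - n * u\<^sup>2) (- n * (v\<^sup>2 - n * u\<^sup>2)) 0 0 0 0)
      (sym_mat ?a (b - n * ?a) 1 d 0 0)
      (sym_mat 1 (- n) 0 0 0 0) (sym_mat 0 b 1 d 0 0)"
    by (rule pencil_reduces_combI[of "1 / (v\<^sup>2 - n * u\<^sup>2)" 1 0 "- ?a / (v\<^sup>2 - n * u\<^sup>2)"])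
      (use M in \<open>simp_all\<close>, simp add: algebra_simps)
  have "code_equivalent (no_line_code n b0 d0)
      (pencil_perp (sym_mat 1 (- n) 0 0 0 0) (sym_mat 0 b 1 d 0 0))"
    using pencil_reduces_trans[OF r1 r2] by (simp add: pencil_reduces_def no_line_code_def)
  then show ?thesis
    unfolding classified_def using code_equivalent_sym by blast
qed

text \<open>The singular member is a binary form in x and y. Either it splits into lines, or it is
  anisotropic and becomes x^2 - n y^2 after completing the square and scaling.\<close>

lemma classified_singular_member:
  fixes n b0 d0 :: "'a::{field,finite}"
  assumes two: "(2::'a) \<noteq> 0" and n: "\<nexists>r. n = r\<^sup>2" and N0: "\<nexists>r. b0\<^sup>2 - 4 * n * d0\<^sup>2 = r\<^sup>2"
    and Q: "Q \<in> Sym3" and bf: "base_free (sym_mat a b 0 d 0 0) Q"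
  shows "classified n b0 d0 (pencil_perp (sym_mat a b 0 d 0 0) Q)"
proof -
  obtain a' b' c' d' e' f' where Q': "Q = sym_mat a' b' c' d' e' f'"
    using Q by (rule Sym3E)
  note bf' = bf[unfolded Q']
  show ?thesis
  proof (cases "a = 0")
    case True
    \<comment> \<open>If the first form were zero, any nontrivial zero of Q would be a base
      point.\<close>
    have "b \<noteq> 0 \<or> d \<noteq> 0"
    proof (rule ccontr)
      assume "\<not> (b \<noteq> 0 \<or> d \<noteq> 0)"
      then have "qform (sym_mat a b 0 d 0 0) x = 0" for x
        using True by (cases x rule: vector3_cases) simp
      moreover obtain x where "x \<noteq> 0" "qform Q x = 0"
        using ternary_form_isotropic[OF two Q] .
      ultimately show False
        using bf unfolding base_free_def by blast
    qed
    moreover have r: "pencil_reduces (sym_mat a b 0 d 0 0) Q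
        (sym_mat b 0 0 d 0 0) (sym_mat b' a' c' d' f' e')"
      by (rule pencil_reduces_cols[OF refl, of 0 1 0 1 0 0 0 0 1])
        (simp_all add: Q' True congruence_sym_mat)
    ultimately show ?thesis
      by (intro classified_reduces[OF r] classified_reducible_member two n
          pencil_reduces_base_free[OF r bf]) auto
  next
    case a: False
    let ?k = "(b - d\<^sup>2 / a) / a"
    obtain Q1 where Q1: "Q1 \<in> Sym3" and r0: "pencil_reduces (sym_mat a b 0 d 0 0) Q
      (sym_mat a (b - d\<^sup>2 / a) 0 0 0 0) Q1"
    proof
      let ?A = "col_mat (vector [1, 0, 0]) (vector [- d / a, 1, 0]) (vector [0, 0, 1])"
      show "transpose ?A ** Q ** ?A \<in> Sym3"
        by (simp add: Q congruence_in_Sym3')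
      show "pencil_reduces (sym_mat a b 0 d 0 0) Q
          (sym_mat a (b - d\<^sup>2 / a) 0 0 0 0) (transpose ?A ** Q ** ?A)"
        by (rule pencil_reduces_cols[OF refl, of 1 0 0 "- d / a" 1 0 0 0 1])
          (use a in \<open>simp_all add: congruence_sym_mat field_simps power2_eq_square\<close>)
    qed
    have r1: "pencil_reduces (sym_mat a (b - d\<^sup>2 / a) 0 0 0 0) Q1 (sym_mat 1 ?k 0 0 0 0) Q1"
      by (rule pencil_reduces_combI[of "1 / a" 1 0 0]) (use a in simp_all)
    note r01 = pencil_reduces_trans[OF r0 r1]
    note bf1 = pencil_reduces_base_free[OF r01 bf]
    show ?thesis
    proof (cases "\<exists>r. - ?k = r\<^sup>2")
      case True
      then obtain r where "- ?k = r\<^sup>2" ..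
      then have k: "?k = - r\<^sup>2"
        by (metis minus_minus)
      \<comment> \<open>x^2 - r^2 y^2 becomes x (x + 2 r y) when x + r y is substituted for
        x.\<close>
      let ?A = "col_mat (vector [1, 0, 0]) (vector [r, 1, 0]) (vector [0, 0, 1])"
      have r2: "pencil_reduces (sym_mat 1 ?k 0 0 0 0) Q1 (sym_mat 1 0 0 r 0 0) (transpose ?A ** Q1 ** ?A)"
        unfolding k by (rule pencil_reduces_cols[OF refl, of 1 0 0 r 1 0 0 0 1])
          (simp_all add: congruence_sym_mat power2_eq_square)
      show ?thesis
        by (rule classified_reduces[OF pencil_reduces_trans[OF r01 r2]],
            rule classified_reducible_member[OF two n])
          (simp_all add: Q1 congruence_in_Sym3' pencil_reduces_base_free[OF r2 bf1])
    next
      case False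
      then obtain s where s: "s \<noteq> 0" "- ?k = n * s\<^sup>2"
        using nonsquare_quotient_square[OF two n] by blast
      then have k: "?k = - n * s\<^sup>2"
        by (metis minus_minus minus_mult_left)
      let ?A = "col_mat (vector [1, 0, 0]) (vector [0, 1 / s, 0]) (vector [0, 0, 1])"
      have r2: "pencil_reduces (sym_mat 1 ?k 0 0 0 0) Q1 (sym_mat 1 (- n) 0 0 0 0) (transpose ?A ** Q1 ** ?A)"
        unfolding k by (rule pencil_reduces_cols[OF refl, of 1 0 0 0 "1 / s" 0 0 0 1])
          (use s(1) in \<open>simp_all add: congruence_sym_mat power2_eq_square\<close>)
      obtain a2 b2 c2 d2 e2 f2 where Q2: "transpose ?A ** Q1 ** ?A = sym_mat a2 b2 c2 d2 e2 f2"
        using congruence_in_Sym3'[OF Q1] Sym3E by metis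
      note r02 = pencil_reduces_trans[OF r01 r2[unfolded Q2]]
      note bf2 = pencil_reduces_base_free[OF r02 bf]
      \<comment> \<open>(0, 0, 1) is a zero of x^2 - n y^2.\<close>
      have c2: "c2 \<noteq> 0"
        using base_freeD_vector[OF bf2, of 0 0 1] by auto
      obtain a3 b3 d3 where r3: "pencil_reduces (sym_mat 1 (- n) 0 0 0 0) (sym_mat a2 b2 c2 d2 e2 f2)
          (sym_mat 1 (- n) 0 0 0 0) (sym_mat a3 b3 c2 d3 0 0)"
      proof
        show "pencil_reduces (sym_mat 1 (- n) 0 0 0 0) (sym_mat a2 b2 c2 d2 e2 f2)
          (sym_mat 1 (- n) 0 0 0 0)
          (sym_mat (a2 - e2\<^sup>2 / c2) (b2 - f2\<^sup>2 / c2) c2 (d2 - e2 * f2 / c2) 0 0)"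
          by (rule pencil_reduces_cols[OF refl, of 1 0 "- e2 / c2" 0 1 "- f2 / c2" 0 0 1])
            (use c2 in \<open>simp_all add: congruence_sym_mat field_simps power2_eq_square\<close>)
      qed
      \<comment> \<open>Subtracting a multiple of x^2 - n y^2 clears x^2 at the cost of a new
        coefficient of y^2.\<close>
      have r4: "pencil_reduces (sym_mat 1 (- n) 0 0 0 0) (sym_mat a3 b3 c2 d3 0 0)
          (sym_mat 1 (- n) 0 0 0 0) (sym_mat 0 ((b3 + n * a3) / c2) 1 (d3 / c2) 0 0)"
        by (rule pencil_reduces_combI[of 1 "1 / c2" 0 "- a3 / c2"])
          (use c2 in \<open>simp_all add: field_simps\<close>)
      note r = pencil_reduces_trans[OF r02 pencil_reduces_trans[OF r3 r4]]
      show ?thesis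
        using classified_reduces[OF r] classified_anisotropic_member[OF two n N0]
          pencil_reduces_base_free[OF r bf] by blast
    qed
  qed
qed

text \<open>A null vector taken as last column of A makes the last column of the congruent matrix
  vanish, and by symmetry its last row.\<close>

lemma singular_congruence:
  assumes R: "R \<in> Sym3" and "det R = 0"
  obtains A a b d where "det A \<noteq> 0" "transpose A ** R ** A = sym_mat a b 0 d 0 0"
proof -
  have "\<not> invertible R"
    using assms invertible_det_nz by blast
  then obtain v where v: "v \<noteq> 0" "R *v v = 0"
    using invertible_left_inverse matrix_left_invertible_ker by metis
  obtain u1 u2 u3 w1 w2 w3 v1 v2 v3 where vv: "v = vector [v1, v2, v3]" and
    det: "det (col_mat (vector [u1, u2, u3]) (vector [w1, w2, w3]) (vector [v1, v2, v3])) \<noteq> 0"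
    (is "det ?A \<noteq> 0")
    using extend_to_col_mat[OF v(1)] .
  obtain a b c d e f where R': "transpose ?A ** R ** ?A = sym_mat a b c d e f"
    using congruence_in_Sym3'[OF R] Sym3E by metis
  have "?A *v vector [0, 0, 1] = v"
    by (simp add: vv col_mat_def vec_eq_iff forall_3 matrix_vector_mult_def sum_3 transpose_def)
  then have "sym_mat a b c d e f *v vector [0, 0, 1] = 0"
    unfolding R'[symmetric] using v(2)
    by (simp add: matrix_vector_mul_assoc[symmetric])
  then have "c = 0" "e = 0" "f = 0"
    by (simp_all add: vec_eq_iff forall_3 matrix_vector_mult_def sum_3)
  then show ?thesis
    using that[OF det] R' by blast
qed

lemma base_free_pencil_classification:
  fixes n b0 d0 :: "'a::{field,finite}"
  assumes two: "(2::'a) \<noteq> 0" and n: "\<nexists>r. n = r\<^sup>2" and N0: "\<nexists>r. b0\<^sup>2 - 4 * n * d0\<^sup>2 = r\<^sup>2"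
    and P: "P \<in> Sym3" and Q: "Q \<in> Sym3" and bf: "base_free P Q"
  shows "classified n b0 d0 (pencil_perp P Q)"
proof -
  obtain s t where st: "s \<noteq> 0 \<or> t \<noteq> 0" and det: "det (mat_scale s P + mat_scale t Q) = 0"
    using base_free_pencil_degenerate_member[OF two P Q bf] .
  define R where "R = mat_scale s P + mat_scale t Q"
  have R: "R \<in> Sym3"
    unfolding R_def using P Q by (intro add_in_Sym3 mat_scale_in_Sym3)
  \<comment> \<open>Either original generator completes R to a basis of the pencil, provided R
    involves the other one.\<close>
  obtain S where S: "S \<in> Sym3" and r1: "pencil_reduces P Q R S"
  proof (cases "s = 0")
    case True
    have "pencil_reduces P Q R P"
      by (rule pencil_reduces_combI[of s 0 t 1]) (use st True in \<open>auto simp: R_def\<close>)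
    then show ?thesis using that P by blast
  next
    case False
    have "pencil_reduces P Q R Q"
      by (rule pencil_reduces_combI[of s 1 t 0]) (use False in \<open>auto simp: R_def\<close>)
    then show ?thesis using that Q by blast
  qed
  obtain A a b d where det: "det A \<noteq> 0" and R': "transpose A ** R ** A = sym_mat a b 0 d 0 0"
    using singular_congruence[OF R] det R_def by blast
  have r2: "pencil_reduces R S (sym_mat a b 0 d 0 0) (transpose A ** S ** A)"
    using pencil_reduces_congruence[OF det, of R S] R' by simp
  note r = pencil_reduces_trans[OF r1 r2]
  show ?thesis
    by (rule classified_reduces[OF r], rule classified_singular_member[OF two n N0])
      (simp_all add: S congruence_in_Sym3' pencil_reduces_base_free[OF r bf])
qed

section \<open>Rank-one-free subspaces\<close>

text \<open>The scalar \<open>k\<close> accounts for rank-one symmetric matrices that are a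
  nonsquare times an \<open>outer u\<close>. The zero matrix has the same shape, hence the form of
  the conclusion.\<close>

definition rank_one_free :: "('a::{field,finite}^3^3) set \<Rightarrow> bool"
  where "rank_one_free C \<longleftrightarrow> (\<forall>k u. mat_scale k (outer u) \<in> C \<longrightarrow> mat_scale k (outer u) = 0)"

lemma outer_eq_0_iff [simp]: "outer u = 0 \<longleftrightarrow> u = 0"
  by (auto simp: outer_def vec_eq_iff forall_3)

lemma mat_scale_outer_scale: "mat_scale k (outer (t *s u)) = mat_scale (k * t\<^sup>2) (outer u)"
  by (simp add: outer_def vec_eq_iff power2_eq_square)

lemma trace_mult_mat_scale: "trace (P ** mat_scale k X) = k * trace (P ** X)"
  for P :: "'a::field^3^3"
  by (simp add: trace_def matrix_matrix_mult_def sum_3 algebra_simps)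

lemma trace_mult_add: "trace (P ** (X + Y)) = trace (P ** X) + trace (P ** Y)"
  for P :: "'a::field^3^3"
  by (simp add: trace_def matrix_matrix_mult_def sum_3 algebra_simps)

lemma subspace_Sym3: "matvs.subspace (Sym3 :: ('a::{field,finite}^3^3) set)"
  by (intro matvs.subspaceI) (auto simp: Sym3_iff)

lemma subspace_pencil_perp: "matvs.subspace (pencil_perp P Q)"
proof (rule matvs.subspaceI)
  show "0 \<in> pencil_perp P Q"
    by (simp add: pencil_perp_def Sym3_iff trace_def matrix_matrix_mult_def)
qed (auto simp: pencil_perp_def trace_mult_add trace_mult_mat_scale add_in_Sym3 mat_scale_in_Sym3)

lemma rank_one_free_pencil_perp_iff: "rank_one_free (pencil_perp P Q) \<longleftrightarrow> base_free P Q"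
proof
  assume r: "rank_one_free (pencil_perp P Q)"
  show "base_free P Q"
    unfolding base_free_def
  proof (intro allI impI)
    fix x assume "qform P x = 0" "qform Q x = 0"
    then have "mat_scale 1 (outer x) \<in> pencil_perp P Q"
      by (simp add: pencil_perp_def qform_def)
    then show "x = 0"
      using r unfolding rank_one_free_def by (metis matvs.scale_one outer_eq_0_iff)
  qed
next
  assume b: "base_free P Q"
  show "rank_one_free (pencil_perp P Q)"
    unfolding rank_one_free_def
  proof (intro allI impI)
    fix k u assume "mat_scale k (outer u) \<in> pencil_perp P Q"
    then have "k = 0 \<or> qform P u = 0 \<and> qform Q u = 0"
      by (auto simp: pencil_perp_def trace_mult_mat_scale qform_def)
    then show "mat_scale k (outer u) = 0"
      using b unfolding base_free_def by auto
  qed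
qed

section \<open>Rank of symmetric matrices and minimum distance\<close>

lemma rank_eq_0_iff: "rank X = 0 \<longleftrightarrow> X = 0" for X :: "'a::field^'n^'m"
proof -
  have "rank X = 0 \<longleftrightarrow> rows X \<subseteq> {0}"
    by (simp add: row_rank_def_gen vec.dim_eq_0)
  also have "\<dots> \<longleftrightarrow> (\<forall>i. row i X = 0)"
    by (auto simp: rows_def)
  also have "\<dots> \<longleftrightarrow> X = 0"
    by (auto simp: row_def vec_eq_iff)
  finally show ?thesis .
qed

lemma rank_le_3: "rank X \<le> 3" for X :: "'a::field^3^3"
  using dim_subset_UNIV_cart_gen[of "rows X"] by (simp add: row_rank_def_gen)

lemma rank_eq_3_iff: "rank X = 3 \<longleftrightarrow> det X \<noteq> 0" for X :: "'a::field^3^3"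
proof -
  have "rank X = 3 \<longleftrightarrow> vec.span (rows X) = UNIV"
    using vec.dim_eq_full[of "rows X"] by (simp add: row_rank_def_gen vec.dimension_def card_cart_basis)
  also have "\<dots> \<longleftrightarrow> invertible X"
    by (simp add: invertible_left_inverse matrix_left_invertible_span_rows_gen)
  finally show ?thesis
    by (simp add: invertible_det_nz)
qed

text \<open>The rows of a matrix of rank one are multiples c i of a single vector u; symmetry,
  comparing the entries (i, l) and (l, i) where u l \<noteq> 0, makes the coefficients c
  proportional to u.\<close>

lemma rank_le_1_iff:
  fixes X :: "'a::{field,finite}^3^3"
  assumes "X \<in> Sym3"
  shows "rank X \<le> 1 \<longleftrightarrow> (\<exists>k u. X = mat_scale k (outer u))"
proof
  assume "\<exists>k u. X = mat_scale k (outer u)"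
  then obtain k u where X: "X = mat_scale k (outer u)"
    by blast
  have "row i X = (k * u $ i) *s u" for i
    by (simp add: X row_def outer_def vec_eq_iff)
  then have "row i X \<in> vec.span {u}" for i
    by (metis insertI1 vec.span_base vec.span_scale)
  then have "rows X \<subseteq> vec.span {u}"
    by (auto simp: rows_def)
  then show "rank X \<le> 1"
    using vec.dim_le_card[of "rows X" "{u}"] by (simp add: row_rank_def_gen)
next
  assume r: "rank X \<le> 1"
  show "\<exists>k u. X = mat_scale k (outer u)"
  proof (cases "X = 0")
    case True
    then have "X = mat_scale 0 (outer 0)"
      by simp
    then show ?thesis by blast
  next
    case False
    obtain B where B: "B \<subseteq> rows X" "vec.independent B" "rows X \<subseteq> vec.span B" "card B = vec.dim (rows X)"
      by (rule vec.basis_exists)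
    have "card B = 1"
      using B(4) r False rank_eq_0_iff[of X] unfolding row_rank_def_gen by linarith
    then obtain u where u: "B = {u}"
      by (rule card_1_singletonE)
    have "\<exists>c. row i X = c *s u" for i
    proof -
      have "row i X \<in> vec.span {u}"
        using B(3) u by (auto simp: rows_def)
      then show ?thesis
        by (auto simp: vec.span_singleton)
    qed
    then obtain c where c: "\<And>i. row i X = c i *s u"
      by metis
    have X: "X $ i $ j = c i * u $ j" for i j
      using c[of i] by (simp add: row_def vec_eq_iff)
    have sym: "X $ i $ j = X $ j $ i" for i j
      using assms by (simp add: Sym3_def transpose_def vec_eq_iff)
    have "u \<noteq> 0"
      using B(2) u vec.dependent_zero by auto
    then obtain l where l: "u $ l \<noteq> 0"
      by (auto simp: vec_eq_iff)
    define k where "k = c l / u $ l"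
    have "c i = k * u $ i" for i
      using sym[of i l] l unfolding X k_def by (simp add: field_simps)
    then have "X = mat_scale k (outer u)"
      by (simp add: vec_eq_iff X outer_def)
    then show ?thesis by blast
  qed
qed

text \<open>By linearity the differences of distinct codewords are exactly the nonzero codewords.
  Excluding rank one alone leaves minimum 2 or 3, so a codeword of rank two has to be present as
  well.\<close>

lemma min_distance_eq_2_iff:
  fixes C :: "('a::{field,finite}^3^3) set"
  assumes "linear_SRD C"
  shows "min_distance C = 2 \<longleftrightarrow> rank_one_free C \<and> (\<exists>X\<in>C. rank X = 2)"
proof -
  have sub: "matvs.subspace C" and Sym: "C \<subseteq> Sym3" and card: "card C \<ge> 2"
    using assms by (auto simp: linear_SRD_def)
  let ?R = "{rank (X - Y) | X Y. X \<in> C \<and> Y \<in> C \<and> X \<noteq> Y}"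
  have R: "?R = rank ` (C - {0})"
  proof (intro equalityI subsetI)
    fix r assume "r \<in> ?R"
    then show "r \<in> rank ` (C - {0})"
      using matvs.subspace_diff[OF sub] by fastforce
  next
    fix r assume "r \<in> rank ` (C - {0})"
    then obtain X where "X \<in> C" "X \<noteq> 0" "r = rank (X - 0)"
      by auto
    then show "r \<in> ?R"
      using matvs.subspace_0[OF sub] by blast
  qed
  have ne: "C - {0} \<noteq> {}"
  proof
    assume "C - {0} = {}"
    then have "card C \<le> card {0 :: 'a^3^3}"
      by (intro card_mono) auto
    then show False using card by simp
  qed
  have rof: "rank_one_free C \<longleftrightarrow> (\<forall>X\<in>C - {0}. 2 \<le> rank X)"
  proof
    assume r: "rank_one_free C"
    show "\<forall>X\<in>C - {0}. 2 \<le> rank X"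
    proof
      fix X assume X: "X \<in> C - {0}"
      have "\<not> rank X \<le> 1"
        using X r Sym rank_le_1_iff[of X] unfolding rank_one_free_def by blast
      then show "2 \<le> rank X" by simp
    qed
  next
    assume r: "\<forall>X\<in>C - {0}. 2 \<le> rank X"
    show "rank_one_free C"
      unfolding rank_one_free_def
    proof (intro allI impI)
      fix k u assume X: "mat_scale k (outer u) \<in> C"
      then have le: "rank (mat_scale k (outer u)) \<le> 1"
        using rank_le_1_iff Sym by blast
      show "mat_scale k (outer u) = 0"
      proof (rule ccontr)
        assume "mat_scale k (outer u) \<noteq> 0"
        then have "2 \<le> rank (mat_scale k (outer u))"
          using r X by blast
        then show False
          using le by simp
      qed
    qed
  qed
  have "min_distance C = 2 \<longleftrightarrow> 2 \<in> rank ` (C - {0}) \<and> (\<forall>r\<in>rank ` (C - {0}). 2 \<le> r)"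
    unfolding min_distance_def R using ne by (intro Min_eq_iff) auto
  also have "\<dots> \<longleftrightarrow> rank_one_free C \<and> (\<exists>X\<in>C. rank X = 2)"
    unfolding rof using rank_eq_0_iff by (force simp: image_iff)
  finally show ?thesis .
qed

section \<open>Annihilators of codimension two and separating forms\<close>

lemma card_Sym3: "card (Sym3 :: ('a::{field,finite}^3^3) set) = CARD('a) ^ 6"
proof -
  let ?f = "\<lambda>(a, b, c, d, e, f). sym_mat a b c d e f :: 'a^3^3"
  have "X \<in> range ?f" if "X \<in> Sym3" for X
  proof -
    obtain a b c d e f where "X = ?f (a, b, c, d, e, f)"
      using Sym3E[OF \<open>X \<in> Sym3\<close>] by fastforce
    then show ?thesis by blast
  qed
  then have S: "Sym3 = range ?f"
    by auto
  have "inj ?f"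
    by (auto simp: inj_on_def)
  then have "card (Sym3 :: ('a^3^3) set) = CARD('a \<times> 'a \<times> 'a \<times> 'a \<times> 'a \<times> 'a)"
    unfolding S by (rule card_image)
  then show ?thesis
    by (simp only: card_prod) (simp add: power_numeral_reduce)
qed

text \<open>The values of the two functionals on M and R form a triangular matrix with nonzero
  diagonal, so \<open>Sym3\<close> is the direct sum of the annihilator and the lines through M and
  R.\<close>

lemma card_pencil_perp:
  fixes P Q :: "'a::{field,finite}^3^3"
  assumes M: "M \<in> Sym3" "trace (P ** M) \<noteq> 0"
    and R: "R \<in> Sym3" "trace (P ** R) = 0" "trace (Q ** R) \<noteq> 0"
  shows "card (pencil_perp P Q) = CARD('a) ^ 4"
proof -
  let ?f = "\<lambda>(X, a, b). X + mat_scale a M + mat_scale b R"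
  have bij: "bij_betw ?f (pencil_perp P Q \<times> UNIV \<times> UNIV) Sym3"
  proof (rule bij_betw_imageI)
    show "inj_on ?f (pencil_perp P Q \<times> UNIV \<times> UNIV)"
    proof (rule inj_onI)
      fix x y
      assume "x \<in> pencil_perp P Q \<times> UNIV \<times> UNIV" "y \<in> pencil_perp P Q \<times> UNIV \<times> UNIV"
        and f: "?f x = ?f y"
      then obtain X a b Y c d where x: "x = (X, a, b)" and y: "y = (Y, c, d)"
        and X: "X \<in> pencil_perp P Q" and Y: "Y \<in> pencil_perp P Q"
        by auto
      have eq: "X + mat_scale a M + mat_scale b R = Y + mat_scale c M + mat_scale d R"
        using f by (simp add: x y)
      have "trace (P ** (X + mat_scale a M + mat_scale b R)) = a * trace (P ** M)"
        "trace (P ** (Y + mat_scale c M + mat_scale d R)) = c * trace (P ** M)"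
        using X Y R by (simp_all add: trace_mult_add trace_mult_mat_scale pencil_perp_def)
      then have "a * trace (P ** M) = c * trace (P ** M)"
        unfolding eq by metis
      then have ac: "a = c"
        using M by simp
      have "trace (Q ** (X + mat_scale a M + mat_scale b R)) = a * trace (Q ** M) + b * trace (Q ** R)"
        "trace (Q ** (Y + mat_scale c M + mat_scale d R)) = c * trace (Q ** M) + d * trace (Q ** R)"
        using X Y by (simp_all add: trace_mult_add trace_mult_mat_scale pencil_perp_def)
      then have "a * trace (Q ** M) + b * trace (Q ** R) = c * trace (Q ** M) + d * trace (Q ** R)"
        unfolding eq by metis
      then have "b = d"
        using ac R by simp
      then show "x = y"
        using ac eq by (simp add: x y)
    qed
    show "?f ` (pencil_perp P Q \<times> UNIV \<times> UNIV) = Sym3"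
    proof (intro equalityI subsetI)
      fix Y assume "Y \<in> ?f ` (pencil_perp P Q \<times> UNIV \<times> UNIV)"
      then show "Y \<in> Sym3"
        using M R by (auto simp: pencil_perp_def intro!: add_in_Sym3 mat_scale_in_Sym3)
    next
      fix Y :: "'a^3^3" assume Y: "Y \<in> Sym3"
      \<comment> \<open>a and b solve the triangular system that makes both traces of X
        vanish.\<close>
      define a where "a = trace (P ** Y) / trace (P ** M)"
      define b where "b = (trace (Q ** Y) - a * trace (Q ** M)) / trace (Q ** R)"
      define X where "X = Y + mat_scale (- a) M + mat_scale (- b) R"
      have "X \<in> Sym3"
        unfolding X_def using Y M R by (intro add_in_Sym3 mat_scale_in_Sym3)
      moreover have "trace (P ** X) = 0"
        unfolding X_def trace_mult_add trace_mult_mat_scale using M R by (simp add: a_def)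
      moreover have "trace (Q ** X) = 0"
        unfolding X_def trace_mult_add trace_mult_mat_scale using R by (simp add: b_def)
      ultimately have "X \<in> pencil_perp P Q"
        by (simp add: pencil_perp_def)
      moreover have "Y = ?f (X, a, b)"
        by (simp add: X_def)
      ultimately show "Y \<in> ?f ` (pencil_perp P Q \<times> UNIV \<times> UNIV)"
        by blast
    qed
  qed
  have "card (pencil_perp P Q) * (CARD('a) * CARD('a)) = CARD('a) ^ 6"
    using bij_betw_same_card[OF bij] by (simp only: card_cartesian_product card_Sym3)
  then have "card (pencil_perp P Q) * (CARD('a) * CARD('a)) = CARD('a) ^ 4 * (CARD('a) * CARD('a))"
    by (simp add: power_numeral_reduce)
  then show ?thesis
    by simp
qed

text \<open>A functional that is 0 on C and 1 at M exists by extension from an independent set;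
  since 2 is invertible, every functional on \<open>Sym3\<close> is the trace pairing with a
  symmetric matrix.\<close>

lemma separating_form:
  fixes C :: "('a::{field,finite}^3^3) set"
  assumes two: "(2::'a) \<noteq> 0" and sub: "matvs.subspace C" and "C \<subseteq> Sym3" "M \<in> Sym3" "M \<notin> C"
  obtains P where "P \<in> Sym3" "\<And>X. X \<in> C \<Longrightarrow> trace (P ** X) = 0" "trace (P ** M) \<noteq> 0"
proof -
  interpret vp: vector_space_pair "mat_scale :: 'a \<Rightarrow> 'a^3^3 \<Rightarrow> 'a^3^3" "(*) :: 'a \<Rightarrow> 'a \<Rightarrow> 'a"
    by unfold_locales (simp_all add: algebra_simps)
  obtain B where B: "B \<subseteq> C" "matvs.independent B" "C \<subseteq> matvs.span B" "card B = matvs.dim C"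
    by (rule matvs.basis_exists)
  have span: "matvs.span B = C"
    using sub B by (metis matvs.span_minimal subset_antisym)
  then have "matvs.independent (insert M B)"
    using B assms(5) by (simp add: matvs.independent_insert)
  then obtain g where lin: "Vector_Spaces.linear mat_scale (*) g"
    and g: "\<And>X. X \<in> insert M B \<Longrightarrow> g X = (if X = M then 1 else 0)"
    using vp.linear_independent_extend[of "insert M B" "\<lambda>X. if X = M then 1 else 0"] by blast
  \<comment> \<open>Off-diagonal entries occur twice in the trace, hence the halves.\<close>
  define P where "P = sym_mat (g (sym_mat 1 0 0 0 0 0)) (g (sym_mat 0 1 0 0 0 0))
    (g (sym_mat 0 0 1 0 0 0)) (g (sym_mat 0 0 0 1 0 0) / 2) (g (sym_mat 0 0 0 0 1 0) / 2)
    (g (sym_mat 0 0 0 0 0 1) / 2)"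
  have tr: "trace (P ** X) = g X" if "X \<in> Sym3" for X
  proof -
    obtain a b c d e f where X: "X = sym_mat a b c d e f"
      using \<open>X \<in> Sym3\<close> by (rule Sym3E)
    have "X = mat_scale a (sym_mat 1 0 0 0 0 0) + mat_scale b (sym_mat 0 1 0 0 0 0)
      + mat_scale c (sym_mat 0 0 1 0 0 0) + mat_scale d (sym_mat 0 0 0 1 0 0)
      + mat_scale e (sym_mat 0 0 0 0 1 0) + mat_scale f (sym_mat 0 0 0 0 0 1)"
      by (simp add: X)
    then have "g X = a * g (sym_mat 1 0 0 0 0 0) + b * g (sym_mat 0 1 0 0 0 0)
      + c * g (sym_mat 0 0 1 0 0 0) + d * g (sym_mat 0 0 0 1 0 0)
      + e * g (sym_mat 0 0 0 0 1 0) + f * g (sym_mat 0 0 0 0 0 1)"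
      by (simp only: vp.linear_add[OF lin] vp.linear_scale[OF lin])
    then show ?thesis
      using two by (simp add: X P_def trace_sym_mat_mult field_simps)
  qed
  show ?thesis
  proof
    show "P \<in> Sym3"
      by (simp add: P_def)
    show "trace (P ** M) \<noteq> 0"
      using tr g assms(4) by simp
    fix X assume X: "X \<in> C"
    have "g X = 0"
      by (rule vp.linear_eq_0_on_span[OF lin, of B])
        (use g B(1) assms(5) X span in auto)
    then show "trace (P ** X) = 0"
      using tr X assms(3) by auto
  qed
qed

text \<open>A nonzero form P annihilating C has a nontrivial zero x. As \<open>outer x\<close> is
  not in C, a second annihilating form Q can be chosen nonzero at x, hence independent of P.\<close>

lemma rank_one_free_subset_pencil_perp:
  fixes C :: "('a::{field,finite}^3^3) set"
  assumes two: "(2::'a) \<noteq> 0" and sub: "matvs.subspace C" and C: "C \<subseteq> Sym3" and r: "rank_one_free C"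
  obtains P Q where "P \<in> Sym3" "Q \<in> Sym3" "C \<subseteq> pencil_perp P Q" "card (pencil_perp P Q) = CARD('a) ^ 4"
proof -
  have nC: "outer x \<notin> C" if "x \<noteq> 0" for x
    using r that unfolding rank_one_free_def by (metis matvs.scale_one outer_eq_0_iff)
  have e1: "(vector [1, 0, 0] :: 'a^3) \<noteq> 0"
    by simp
  obtain P where P: "P \<in> Sym3" "\<And>X. X \<in> C \<Longrightarrow> trace (P ** X) = 0"
      "trace (P ** outer (vector [1, 0, 0])) \<noteq> 0"
    using separating_form[OF two sub C outer_in_Sym3 nC[OF e1]] by blast
  obtain x where x: "x \<noteq> 0" "qform P x = 0"
    using ternary_form_isotropic[OF two P(1)] .
  obtain Q where Q: "Q \<in> Sym3" "\<And>X. X \<in> C \<Longrightarrow> trace (Q ** X) = 0" "trace (Q ** outer x) \<noteq> 0"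
    using separating_form[OF two sub C outer_in_Sym3 nC[OF x(1)]] by blast
  have "card (pencil_perp P Q) = CARD('a) ^ 4"
    by (rule card_pencil_perp[OF outer_in_Sym3 P(3) outer_in_Sym3 _ Q(3)])
      (use x in \<open>simp add: qform_def\<close>)
  moreover have "C \<subseteq> pencil_perp P Q"
    using C P(2) Q(2) by (auto simp: pencil_perp_def)
  ultimately show ?thesis
    using that P(1) Q(1) by blast
qed

section \<open>Complete codes\<close>

text \<open>Congruence reduces this to a binary form, which is diagonalized by completing a square
  or, if both squares are missing, along (1, 1) and (1, -1).\<close>

lemma singular_sum_outer:
  fixes X :: "'a::{field,finite}^3^3"
  assumes two: "(2::'a) \<noteq> 0" and "X \<in> Sym3" "det X = 0"
  obtains k x l y where "X = mat_scale k (outer x) + mat_scale l (outer y)"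
proof -
  obtain A a b d where A: "det A \<noteq> 0" and eq: "transpose A ** X ** A = sym_mat a b 0 d 0 0"
    using singular_congruence[OF assms(2,3)] .
  obtain B where B: "A ** B = mat 1"
    using A invertible_det_nz invertible_def by metis
  then have BT: "transpose B ** transpose A = mat 1"
    by (metis matrix_transpose_mul transpose_mat)
  have X: "transpose B ** (transpose A ** X ** A) ** B = X"
    by (metis B BT matrix_mul_assoc matrix_mul_lid matrix_mul_rid)
  obtain k x l y where "sym_mat a b 0 d 0 0 = mat_scale k (outer x) + mat_scale l (outer y)"
  proof (cases "a = 0")
    case False
    have "sym_mat a b 0 d 0 0 = mat_scale (1 / a) (outer (vector [a, d, 0]))
      + mat_scale (b - d\<^sup>2 / a) (outer (vector [0, 1, 0]))"
      using False by (simp add: outer_vector power2_eq_square)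
    then show ?thesis using that by blast
  next
    case a: True
    show ?thesis
    proof (cases "b = 0")
      case False
      have "sym_mat a b 0 d 0 0 = mat_scale (1 / b) (outer (vector [d, b, 0]))
        + mat_scale (- d\<^sup>2 / b) (outer (vector [1, 0, 0]))"
        using False a by (simp add: outer_vector power2_eq_square)
      then show ?thesis using that by blast
    next
      case True
      have "sym_mat a b 0 d 0 0 = mat_scale (d / 2) (outer (vector [1, 1, 0]))
        + mat_scale (- d / 2) (outer (vector [1, - 1, 0]))"
        using True a two by (simp add: outer_vector field_simps)
      then show ?thesis using that by blast
    qed
  qed
  then have "X = transpose B ** (mat_scale k (outer x) + mat_scale l (outer y)) ** B"
    using X eq by simp
  also have "\<dots> = mat_scale k (outer (transpose B *v x)) + mat_scale l (outer (transpose B *v y))"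
    unfolding outer_mult
    by (simp add: vec_eq_iff forall_3 matrix_matrix_mult_def sum_3 algebra_simps)
  finally show ?thesis
    using that by blast
qed

text \<open>N holds a representative of each point of the projective plane; t = 0 covers the zero
  vector.\<close>

lemma normalized_points:
  obtains N :: "('a::{field,finite}^3) set" where "card N \<le> CARD('a)\<^sup>2 + CARD('a) + 1"
    "\<And>u. \<exists>p\<in>N. \<exists>t. u = t *s p"
proof
  let ?A = "range (\<lambda>(y, z). vector [1, y, z] :: 'a^3)" and ?B = "range (\<lambda>z. vector [0, 1, z] :: 'a^3)"
  let ?C = "{vector [0, 0, 1] :: 'a^3}"
  have "card ?A \<le> CARD('a \<times> 'a)" "card ?B \<le> CARD('a)"
    by (rule card_image_le, simp)+
  moreover have "card (?A \<union> ?B \<union> ?C) \<le> card ?A + card ?B + card ?C"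
    by (meson add_le_mono1 card_Un_le order_trans)
  ultimately show "card (?A \<union> ?B \<union> ?C) \<le> CARD('a)\<^sup>2 + CARD('a) + 1"
    by (simp add: power2_eq_square)
  fix u :: "'a^3"
  obtain x y z where u: "u = vector [x, y, z]"
    by (rule vector3_cases)
  consider "x \<noteq> 0" | "x = 0" "y \<noteq> 0" | "x = 0" "y = 0"
    by blast
  then show "\<exists>p\<in>?A \<union> ?B \<union> ?C. \<exists>t. u = t *s p"
  proof cases
    case 1
    then have "u = x *s (\<lambda>(y, z). vector [1, y, z]) (y / x, z / x)"
      by (simp add: u vec_eq_iff forall_3)
    then show ?thesis by blast
  next
    case 2
    then have "u = y *s vector [0, 1, z / y]"
      by (simp add: u vec_eq_iff forall_3)
    then show ?thesis by blast
  next
    case 3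
    then have "u = z *s vector [0, 0, 1]"
      by (simp add: u vec_eq_iff forall_3)
    then show ?thesis by blast
  qed
qed

text \<open>
  Modulo \<open>C\<close> the \<open>q\<^sup>2 + q + 1\<close> rank-one directions give at most \<open>q\<^sup>2 + q\<close> points, since a
  rank-two element \<open>k x x\<^sup>T + l y y\<^sup>T\<close> of \<open>C\<close> identifies two of them.
\<close>

lemma rank_one_free_extend:
  fixes C :: "('a::{field,finite}^3^3) set"
  assumes two: "(2::'a) \<noteq> 0" and sub: "matvs.subspace C" and C: "C \<subseteq> Sym3" and r: "rank_one_free C"
    and X: "X \<in> C" "rank X = 2" and card: "card C \<le> CARD('a) ^ 3"
  obtains M where "M \<in> Sym3" "M \<notin> C" "rank_one_free (matvs.span (insert M C))"
proof -
  let ?q = "CARD('a)"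
  obtain N :: "('a^3) set" where N: "card N \<le> ?q\<^sup>2 + ?q + 1" "\<And>u. \<exists>p\<in>N. \<exists>t. u = t *s p"
    using normalized_points[where 'a='a] by blast
  have XS: "X \<in> Sym3"
    using X C by blast
  have not_outer: "X \<noteq> mat_scale k (outer u)" for k u
    using rank_le_1_iff[OF XS] X(2) by auto
  have "det X = 0"
    using X(2) rank_eq_3_iff[of X] by auto
  then obtain k0 x0 l0 y0 where "X = mat_scale k0 (outer x0) + mat_scale l0 (outer y0)"
    using singular_sum_outer[OF two XS] by blast
  moreover obtain x tx where x: "x \<in> N" "x0 = tx *s x"
    using N(2) by blast
  moreover obtain y ty where y: "y \<in> N" "y0 = ty *s y"
    using N(2) by blast
  ultimately obtain k l where kl: "X = mat_scale k (outer x) + mat_scale l (outer y)"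
    by (auto simp: mat_scale_outer_scale)
  \<comment> \<open>If k = 0 or x = y, then X would be a multiple of a single \<open>outer\<close>
    matrix, contrary to rank two.\<close>
  have k: "k \<noteq> 0"
    using kl not_outer by (metis add_0 matvs.scale_zero_left)
  have xy: "x \<noteq> y"
    using kl not_outer by (metis matvs.scale_left_distrib)
  \<comment> \<open>The direction x is left out of \<open>?T\<close>: modulo C, the relation
    \<open>kl\<close> turns \<open>outer x\<close> into a multiple of
    \<open>outer y\<close>.\<close>
  let ?g = "\<lambda>(c, t, p). c + mat_scale t (outer p)"
  let ?T = "?g ` (C \<times> (UNIV - {0}) \<times> (N - {x}))"
  have bad: "c + mat_scale t (outer u) \<in> C \<union> ?T" if c: "c \<in> C" for c t u
  proof -
    have *: "c + mat_scale t (outer p) \<in> C \<union> ?T" if "c \<in> C" "p \<in> N - {x}" for c t p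
    proof (cases "t = 0")
      case True
      then show ?thesis using that by simp
    next
      case False
      then have "c + mat_scale t (outer p) = ?g (c, t, p)" "(c, t, p) \<in> C \<times> (UNIV - {0}) \<times> (N - {x})"
        using that by simp_all
      then show ?thesis by blast
    qed
    obtain p s where p: "p \<in> N" "u = s *s p"
      using N(2) by blast
    define t' where "t' = t * s\<^sup>2"
    have eq: "c + mat_scale t (outer u) = c + mat_scale t' (outer p)"
      by (simp add: p(2) mat_scale_outer_scale t'_def)
    show ?thesis
    proof (cases "p = x")
      case False
      then show ?thesis
        unfolding eq using * c p(1) by blast
    next
      case True
      have "mat_scale t' (outer x) = mat_scale (t' / k) X + mat_scale (- (t' / k) * l) (outer y)"
        using k by (simp add: kl matvs.scale_right_distrib)
      then have sum: "c + mat_scale t (outer u) =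
          (c + mat_scale (t' / k) X) + mat_scale (- (t' / k) * l) (outer y)"
        unfolding eq True by (simp only: add.assoc)
      have "c + mat_scale (t' / k) X \<in> C"
        using sub c X by (intro matvs.subspace_add matvs.subspace_scale)
      moreover have "y \<in> N - {x}"
        using y(1) xy by blast
      ultimately show ?thesis
        unfolding sum by (rule *)
    qed
  qed
  have "card ?T \<le> card (C \<times> (UNIV - {0::'a}) \<times> (N - {x}))"
    by (rule card_image_le) simp
  also have "\<dots> = card C * ((?q - 1) * card (N - {x}))"
    by (simp add: card_cartesian_product card_Diff_singleton)
  also have "\<dots> \<le> card C * ((?q - 1) * (?q\<^sup>2 + ?q))"
    using N(1) x(1) by (intro mult_le_mono2) (simp add: card_Diff_singleton)
  finally have "card (C \<union> ?T) \<le> card C + card C * ((?q - 1) * (?q\<^sup>2 + ?q))"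
    using card_Un_le[of C ?T] by linarith
  also have "\<dots> = card C * (1 + (?q - 1) * (?q\<^sup>2 + ?q))"
    by simp
  also have "\<dots> \<le> ?q ^ 3 * (1 + (?q - 1) * (?q\<^sup>2 + ?q))"
    using card by (rule mult_le_mono1)
  \<comment> \<open>1 + (q - 1)(q^2 + q + 1) is exactly q^3, so dropping a single direction already
    gives strict inequality.\<close>
  also have "\<dots> < ?q ^ 3 * ?q ^ 3"
  proof -
    obtain m where "?q = m + 2"
      using CARD_field_ge_2[where 'a='a] by (metis add.commute le_Suc_ex)
    then have "1 + (?q - 1) * (?q\<^sup>2 + ?q) < ?q ^ 3"
      by (simp add: power2_eq_square power3_eq_cube algebra_simps)
    then show ?thesis
      by (rule mult_strict_left_mono) simp
  qed
  also have "\<dots> = card (Sym3 :: ('a^3^3) set)"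
    by (simp add: card_Sym3 flip: power_add)
  finally have "\<not> Sym3 \<subseteq> C \<union> ?T"
    using card_mono[of "C \<union> ?T" Sym3] by fastforce
  then obtain M where M: "M \<in> Sym3" "M \<notin> C \<union> ?T"
    by blast
  have "rank_one_free (matvs.span (insert M C))"
    unfolding rank_one_free_def
  proof (intro allI impI)
    fix t u assume "mat_scale t (outer u) \<in> matvs.span (insert M C)"
    moreover have "matvs.span C = C"
      using sub by (simp add: matvs.span_eq_iff)
    ultimately obtain m where m: "mat_scale t (outer u) - mat_scale m M \<in> C"
      by (auto simp: matvs.span_breakdown_eq)
    show "mat_scale t (outer u) = 0"
    proof (cases "m = 0")
      case True
      then show ?thesis
        using m r unfolding rank_one_free_def by simp
    next
      case False
      \<comment> \<open>Solving for M would put it into the set covered by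
        \<open>bad\<close>.\<close>
      define c where "c = mat_scale t (outer u) - mat_scale m M"
      have "mat_scale (- (1 / m)) c \<in> C"
        using m sub unfolding c_def by (intro matvs.subspace_scale)
      moreover have "M = mat_scale (- (1 / m)) c + mat_scale (t / m) (outer u)"
        using False by (simp add: c_def matvs.scale_right_diff_distrib)
      ultimately have "M \<in> C \<union> ?T"
        using bad by metis
      then show ?thesis
        using M by blast
    qed
  qed
  then show ?thesis
    using that M by blast
qed

text \<open>Evaluation at (1, 0, 0) maps q^4 codewords to q^3 vectors, so some nonzero codeword
  kills this vector; it is singular, and rank one is excluded.\<close>

lemma rank_one_free_card_ex_rank_2:
  fixes C :: "('a::{field,finite}^3^3) set"
  assumes sub: "matvs.subspace C" and C: "C \<subseteq> Sym3" and r: "rank_one_free C"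
    and card: "card C = CARD('a) ^ 4"
  obtains X where "X \<in> C" "rank X = 2"
proof -
  let ?e = "vector [1, 0, 0] :: 'a^3"
  have "card ((\<lambda>X. X *v ?e) ` C) \<le> CARD('a) ^ 3"
    using card_mono[of UNIV "(\<lambda>X. X *v ?e) ` C"] by simp
  also have "\<dots> < card C"
    using card CARD_field_ge_2[where 'a='a] by (simp add: power_strict_increasing)
  finally have "\<not> inj_on (\<lambda>X. X *v ?e) C"
    by (rule pigeonhole)
  then obtain X Y where XY: "X \<in> C" "Y \<in> C" "X \<noteq> Y" "X *v ?e = Y *v ?e"
    by (auto simp: inj_on_def)
  define Z where "Z = X - Y"
  have Z: "Z \<in> C" "Z \<noteq> 0" "Z *v ?e = 0"
    using XY matvs.subspace_diff[OF sub] by (auto simp: Z_def matrix_vector_mult_diff_rdistrib)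
  have "\<not> invertible Z"
    using Z(3) invertible_left_inverse matrix_left_invertible_ker[of Z] vector3_eq_0_iff
    by (metis zero_neq_one)
  then have "rank Z \<noteq> 3"
    by (simp add: rank_eq_3_iff invertible_det_nz)
  moreover have "\<not> rank Z \<le> 1"
    using Z C r rank_le_1_iff[of Z] unfolding rank_one_free_def by blast
  ultimately have "rank Z = 2"
    using rank_le_3[of Z] by linarith
  then show ?thesis
    using that Z(1) by blast
qed

text \<open>A rank-one-free code with a rank-two element and at most q^3 elements can be enlarged,
  and no rank-one-free code exceeds q^4 elements. Completeness therefore becomes a condition on the
  cardinality.\<close>

lemma linear_CSRD_2_iff:
  fixes C :: "('a::{field,finite}^3^3) set"
  assumes two: "(2::'a) \<noteq> 0"
  shows "linear_CSRD 2 C \<longleftrightarrow>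
    matvs.subspace C \<and> C \<subseteq> Sym3 \<and> rank_one_free C \<and> card C = CARD('a) ^ 4"
proof
  assume L: "linear_CSRD 2 C"
  then have srd: "linear_SRD C" and min: "min_distance C = 2"
    by (auto simp: linear_CSRD_def)
  obtain X where sub: "matvs.subspace C" and C: "C \<subseteq> Sym3" and r: "rank_one_free C"
    and X: "X \<in> C" "rank X = 2" and c2: "card C \<ge> 2"
    using min_distance_eq_2_iff[OF srd] srd min by (auto simp: linear_SRD_def)
  obtain P Q where PQ: "C \<subseteq> pencil_perp P Q" "card (pencil_perp P Q) = CARD('a) ^ 4"
    using rank_one_free_subset_pencil_perp[OF two sub C r] by blast
  then have le: "card C \<le> CARD('a) ^ 4"
    by (metis card_mono finite)
  have "\<not> card C \<le> CARD('a) ^ 3"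
  proof
    assume "card C \<le> CARD('a) ^ 3"
    then obtain M where M: "M \<in> Sym3" "M \<notin> C" "rank_one_free (matvs.span (insert M C))"
      using rank_one_free_extend[OF two sub C r X] by blast
    let ?D = "matvs.span (insert M C)"
    have CD: "C \<subset> ?D"
      using M(2) matvs.span_superset by blast
    have "card ?D \<ge> 2"
      using psubset_card_mono[OF _ CD] c2 by simp
    moreover have "?D \<subseteq> Sym3"
      using matvs.span_minimal[OF _ subspace_Sym3, of "insert M C"] M(1) C by simp
    ultimately have "linear_SRD ?D"
      by (simp add: linear_SRD_def)
    \<comment> \<open>The enlarged code still contains the rank-two codeword X.\<close>
    moreover have "min_distance ?D = 2"
      using min_distance_eq_2_iff[OF calculation] M(3) X CD by blast
    ultimately show False
      using L CD unfolding linear_CSRD_def by blast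
  qed
  then have "CARD('a) ^ 3 < CARD('a) ^ matvs.dim C" "CARD('a) ^ matvs.dim C \<le> CARD('a) ^ 4"
    using le card_subspace_eq_power_dim[OF sub] by simp_all
  then have "matvs.dim C = 4"
    using CARD_field_ge_2[where 'a='a] by (simp add: power_strict_increasing_iff power_increasing_iff)
  then show "matvs.subspace C \<and> C \<subseteq> Sym3 \<and> rank_one_free C \<and> card C = CARD('a) ^ 4"
    using sub C r card_subspace_eq_power_dim[OF sub] by simp
next
  assume "matvs.subspace C \<and> C \<subseteq> Sym3 \<and> rank_one_free C \<and> card C = CARD('a) ^ 4"
  then have sub: "matvs.subspace C" and C: "C \<subseteq> Sym3" and r: "rank_one_free C"
    and card: "card C = CARD('a) ^ 4"
    by auto
  have "CARD('a) ^ 1 \<le> CARD('a) ^ 4"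
    by (rule power_increasing) auto
  then have srd: "linear_SRD C"
    using sub C card CARD_field_ge_2[where 'a='a] by (simp add: linear_SRD_def)
  obtain X where "X \<in> C" "rank X = 2"
    using rank_one_free_card_ex_rank_2[OF sub C r card] .
  then have min: "min_distance C = 2"
    using min_distance_eq_2_iff[OF srd] r by blast
  have "\<not> C \<subset> D" if D: "linear_SRD D" "min_distance D = 2" for D
  proof
    assume CD: "C \<subset> D"
    have "matvs.subspace D" "D \<subseteq> Sym3" "rank_one_free D"
      using D min_distance_eq_2_iff[OF D(1)] by (auto simp: linear_SRD_def)
    then obtain P Q where "D \<subseteq> pencil_perp P Q" "card (pencil_perp P Q) = CARD('a) ^ 4"
      using rank_one_free_subset_pencil_perp[OF two] by blast
    then have "card D \<le> card C"
      using card by (metis card_mono finite)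
    then show False
      using psubset_card_mono[OF _ CD] by simp
  qed
  then show "linear_CSRD 2 C"
    using srd min unfolding linear_CSRD_def by blast
qed

lemma linear_CSRD_2_imp_pencil_perp:
  fixes C :: "('a::{field,finite}^3^3) set"
  assumes two: "(2::'a) \<noteq> 0" and "linear_CSRD 2 C"
  obtains P Q where "P \<in> Sym3" "Q \<in> Sym3" "base_free P Q" "C = pencil_perp P Q"
proof -
  have sub: "matvs.subspace C" and C: "C \<subseteq> Sym3" and r: "rank_one_free C"
    and card: "card C = CARD('a) ^ 4"
    using assms linear_CSRD_2_iff[OF two, of C] by auto
  obtain P Q where PQ: "P \<in> Sym3" "Q \<in> Sym3" "C \<subseteq> pencil_perp P Q"
    "card (pencil_perp P Q) = CARD('a) ^ 4"
    using rank_one_free_subset_pencil_perp[OF two sub C r] by blast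
  then have "C = pencil_perp P Q"
    using card by (intro card_subset_eq) auto
  then show ?thesis
    using that PQ r rank_one_free_pencil_perp_iff by blast
qed

section \<open>Inequivalence of the three codes\<close>

text \<open>The last two conditions express that X and Y are linearly independent.\<close>

definition double_kernel :: "('a::field^3^3) set \<Rightarrow> 'a^3 \<Rightarrow> bool"
  where "double_kernel C v \<longleftrightarrow> v \<noteq> 0 \<and>
    (\<exists>X\<in>C. \<exists>Y\<in>C. X *v v = 0 \<and> Y *v v = 0 \<and> X \<noteq> 0 \<and> (\<forall>c. Y \<noteq> mat_scale c X))"

text \<open>If X kills v, then A X B kills the image of v under the inverse of B. The matrix
  obtained is thus the inverse of the right factor of the equivalence.\<close>

lemma double_kernel_equivalent:
  fixes C D :: "('a::{field,finite}^3^3) set"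
  assumes "code_equivalent C D"
  obtains B where "invertible B" "\<And>v. double_kernel C v \<Longrightarrow> double_kernel D (B *v v)"
proof -
  obtain A B where A: "invertible A" and B: "invertible B" and D: "D = {A ** X ** B | X. X \<in> C}"
    using assms unfolding code_equivalent_def by blast
  obtain A' where A': "A' ** A = mat 1"
    using A unfolding invertible_def by blast
  obtain B' where B': "B ** B' = mat 1" "B' ** B = mat 1"
    using B unfolding invertible_def by blast
  have cancel: "A' ** (A ** X ** B) ** B' = X" for X
    by (metis A' B'(1) matrix_mul_assoc matrix_mul_lid matrix_mul_rid)
  have kill: "(A ** X ** B) *v (B' *v v) = A *v (X *v v)" for X v
    by (metis B'(1) matrix_mul_assoc matrix_mul_rid matrix_vector_mul_assoc)
  have scale: "A' ** mat_scale c Z ** B' = mat_scale c (A' ** Z ** B')" for c Z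
    by (simp add: vec_eq_iff forall_3 matrix_matrix_mult_def sum_3 algebra_simps)
  have "double_kernel D (B' *v v)" if dk: "double_kernel C v" for v
  proof -
    obtain X Y where XY: "X \<in> C" "Y \<in> C" "X *v v = 0" "Y *v v = 0" "X \<noteq> 0" "\<And>c. Y \<noteq> mat_scale c X"
      and v: "v \<noteq> 0"
      using dk unfolding double_kernel_def by blast
    have "B' *v v \<noteq> 0"
      using v B'(1) by (metis matrix_vector_mul_assoc matrix_vector_mul_lid matrix_vector_mult_0_right)
    moreover have "A ** X ** B \<in> D" "A ** Y ** B \<in> D"
      using D XY by blast+
    moreover have "(A ** X ** B) *v (B' *v v) = 0" "(A ** Y ** B) *v (B' *v v) = 0"
      unfolding kill using XY by simp_all
    moreover have "A ** X ** B \<noteq> 0"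
    proof
      assume "A ** X ** B = 0"
      then have "A' ** 0 ** B' = X"
        using cancel by metis
      then show False
        using XY(5) by (simp add: vec_eq_iff forall_3 matrix_matrix_mult_def)
    qed
    moreover have "A ** Y ** B \<noteq> mat_scale c (A ** X ** B)" for c
      using cancel scale XY(6) by metis
    ultimately show ?thesis
      unfolding double_kernel_def by blast
  qed
  moreover have "invertible B'"
    using B' unfolding invertible_def by blast
  ultimately show ?thesis
    using that by blast
qed

text \<open>If a single entry vanishes only for the zero matrix among the codewords that kill v,
  these embed linearly into the field and span at most a line.\<close>

lemma not_double_kernelI:
  fixes C :: "('a::field^3^3) set"
  assumes sub: "matvs.subspace C"
    and entry: "\<And>X. X \<in> C \<Longrightarrow> X *v v = 0 \<Longrightarrow> X $ i $ j = 0 \<Longrightarrow> X = 0"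
  shows "\<not> double_kernel C v"
proof
  assume "double_kernel C v"
  then obtain X Y where XY: "X \<in> C" "Y \<in> C" "X *v v = 0" "Y *v v = 0" "X \<noteq> 0" "\<And>c. Y \<noteq> mat_scale c X"
    unfolding double_kernel_def by blast
  have Xij: "X $ i $ j \<noteq> 0"
    using entry XY by blast
  define c where "c = Y $ i $ j / X $ i $ j"
  define Z where "Z = Y - mat_scale c X"
  have "Z \<in> C"
    unfolding Z_def using XY sub by (intro matvs.subspace_diff matvs.subspace_scale)
  moreover have "mat_scale c X *v v = c *s (X *v v)"
    by (simp add: vec_eq_iff matrix_vector_mult_def sum_3 algebra_simps)
  then have "Z *v v = 0"
    using XY by (simp add: Z_def matrix_vector_mult_diff_rdistrib)
  moreover have "Z $ i $ j = 0"
    using Xij by (simp add: Z_def c_def)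
  ultimately have "Z = 0"
    by (rule entry)
  then show False
    using XY(6)[of c] by (simp add: Z_def)
qed

lemma nonsquare_anisotropic:
  fixes n :: "'a::field"
  assumes n: "\<nexists>r. n = r\<^sup>2" and eq: "y\<^sup>2 = n * z\<^sup>2"
  shows "y = 0 \<and> z = 0"
proof -
  have "z = 0"
  proof (rule ccontr)
    assume "z \<noteq> 0"
    then have "n = (y / z)\<^sup>2"
      using eq by (simp add: power_divide)
    then show False
      using n by blast
  qed
  then show ?thesis
    using eq by simp
qed

lemma sym_mat_mult_vector:
  fixes a :: "'a::comm_ring_1"
  shows "sym_mat a b c d e f *v vector [x, y, z] =
    vector [a * x + d * y + e * z, d * x + b * y + f * z, e * x + f * y + c * z]"
  by (simp add: vec_eq_iff forall_3 matrix_vector_mult_def sum_3)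

lemma sym_mat_in_pencil_perp_iff:
  "sym_mat a b c d e f \<in> pencil_perp P Q \<longleftrightarrow>
    trace (P ** sym_mat a b c d e f) = 0 \<and> trace (Q ** sym_mat a b c d e f) = 0"
  by (simp add: pencil_perp_def)

lemma double_kernel_double_line_code: "double_kernel (double_line_code n) (vector [1, 0, 0])"
  unfolding double_kernel_def
  by (intro conjI bexI[of _ "sym_mat 0 n 1 0 0 0"] bexI[of _ "sym_mat 0 0 0 0 0 1"])
    (simp_all add: double_line_code_def sym_mat_in_pencil_perp_iff trace_sym_mat_mult sym_mat_mult_vector)

lemma double_kernel_line_pair_code:
  "double_kernel (line_pair_code n) (vector [1, 0, 0])"
  "double_kernel (line_pair_code n) (vector [0, 1, 0])"
proof -
  show "double_kernel (line_pair_code n) (vector [1, 0, 0])"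
    unfolding double_kernel_def
    by (intro conjI bexI[of _ "sym_mat 0 1 n 0 0 0"] bexI[of _ "sym_mat 0 0 0 0 0 1"])
      (simp_all add: line_pair_code_def sym_mat_in_pencil_perp_iff trace_sym_mat_mult sym_mat_mult_vector)
  show "double_kernel (line_pair_code n) (vector [0, 1, 0])"
    unfolding double_kernel_def
    by (intro conjI bexI[of _ "sym_mat 1 0 n 0 0 0"] bexI[of _ "sym_mat 0 0 0 0 1 0"])
      (simp_all add: line_pair_code_def sym_mat_in_pencil_perp_iff trace_sym_mat_mult sym_mat_mult_vector)
qed

lemma double_kernel_double_line_codeD:
  fixes n :: "'a::{field,finite}"
  assumes n: "\<nexists>r. n = r\<^sup>2" and v: "double_kernel (double_line_code n) (vector [x, y, z])"
  shows "y = 0 \<and> z = 0"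
proof (rule ccontr)
  assume yz: "\<not> (y = 0 \<and> z = 0)"
  have sub: "matvs.subspace (double_line_code n)"
    by (simp add: double_line_code_def subspace_pencil_perp)
  have form: "\<exists>c d e f. X = sym_mat 0 (n * c) c d e f \<and> d * y + e * z = 0 \<and>
      d * x + n * c * y + f * z = 0 \<and> e * x + f * y + c * z = 0"
    if X: "X \<in> double_line_code n" "X *v vector [x, y, z] = 0" for X
  proof -
    have "X \<in> Sym3"
      using X(1) by (simp add: double_line_code_def pencil_perp_def)
    then obtain a b c d e f where X': "X = sym_mat a b c d e f"
      by (rule Sym3E)
    have "a = 0" "b = n * c"
      using X(1) by (simp_all add: X' double_line_code_def sym_mat_in_pencil_perp_iff trace_sym_mat_mult)
    then show ?thesis
      using X(2) by (auto simp: X' sym_mat_mult_vector)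
  qed
  show False
  proof (cases "z = 0")
    case False
    have "X = 0" if X: "X \<in> double_line_code n" "X *v vector [x, y, z] = 0" "X $ 1 $ 2 = 0" for X
    proof -
      obtain c d e f where X': "X = sym_mat 0 (n * c) c d e f" and eqs: "d * y + e * z = 0"
        "d * x + n * c * y + f * z = 0" "e * x + f * y + c * z = 0"
        using form[OF X(1,2)] by blast
      have d: "d = 0" and e: "e = 0"
        using X(3) eqs(1) False by (simp_all add: X')
      \<comment> \<open>This combination of the last two equations eliminates f and leaves an
        anisotropic form in y and z.\<close>
      have "c * (z\<^sup>2 - n * y\<^sup>2) = z * (e * x + f * y + c * z) - y * (d * x + n * c * y + f * z)"
        by (simp add: d e algebra_simps power2_eq_square)
      then have "c = 0 \<or> z\<^sup>2 = n * y\<^sup>2"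
        unfolding eqs by simp
      then have c: "c = 0"
        using nonsquare_anisotropic[OF n, of z y] False by blast
      then have "f = 0"
        using eqs(2) d False by simp
      then show ?thesis
        by (simp add: X' c d e)
    qed
    then show False
      using not_double_kernelI[OF sub] v by blast
  next
    case True
    then have y: "y \<noteq> 0"
      using yz by blast
    have n0: "n \<noteq> 0"
      using n by (metis power_zero_numeral)
    have "X = 0" if X: "X \<in> double_line_code n" "X *v vector [x, y, z] = 0" "X $ 1 $ 3 = 0" for X
    proof -
      obtain c d e f where X': "X = sym_mat 0 (n * c) c d e f" and eqs: "d * y + e * z = 0"
        "d * x + n * c * y + f * z = 0" "e * x + f * y + c * z = 0"
        using form[OF X(1,2)] by blast
      have e: "e = 0" and d: "d = 0"
        using X(3) eqs(1) True y by (simp_all add: X')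
      have "c = 0"
        using eqs(2) d True y n0 by simp
      moreover have "f = 0"
        using eqs(3) e True y by simp
      ultimately show ?thesis
        by (simp add: X' d e)
    qed
    then show False
      using not_double_kernelI[OF sub] v by blast
  qed
qed

text \<open>For z \<noteq> 0, e and f are determined by a and h, which are tied by a linear
  relation. For z = 0, two equations force a = h = 0 and the third ties e to f. Either way the
  codewords killing v span at most a line.\<close>

lemma not_double_kernel_no_line_code:
  fixes n b d :: "'a::{field,finite}"
  assumes two: "(2::'a) \<noteq> 0" and n: "\<nexists>r. n = r\<^sup>2" and N: "\<nexists>r. b\<^sup>2 - 4 * n * d\<^sup>2 = r\<^sup>2"
  shows "\<not> double_kernel (no_line_code n b d) v"
proof
  assume dk: "double_kernel (no_line_code n b d) v"
  have sub: "matvs.subspace (no_line_code n b d)"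
    by (simp add: no_line_code_def subspace_pencil_perp)
  obtain x y z where v: "v = vector [x, y, z]"
    by (rule vector3_cases)
  have form: "\<exists>a h e f. X = sym_mat (n * a) a (- (b * a + 2 * d * h)) h e f \<and>
      n * a * x + h * y + e * z = 0 \<and> h * x + a * y + f * z = 0 \<and>
      e * x + f * y = (b * a + 2 * d * h) * z"
    if X: "X \<in> no_line_code n b d" "X *v v = 0" for X
  proof -
    have "X \<in> Sym3"
      using X(1) by (simp add: no_line_code_def pencil_perp_def)
    then obtain a' a c h e f where X': "X = sym_mat a' a c h e f"
      by (rule Sym3E)
    have "a' - n * a = 0" "b * a + c + 2 * (d * h) = 0"
      using X(1) by (simp_all add: X' no_line_code_def sym_mat_in_pencil_perp_iff trace_sym_mat_mult)
    then have ac: "a' = n * a" "c = - (b * a + 2 * d * h)"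
      by (simp_all add: eq_neg_iff_add_eq_0 algebra_simps)
    have "n * a * x + h * y + e * z = 0" "h * x + a * y + f * z = 0"
      "e * x + f * y + - (b * a + 2 * d * h) * z = 0"
      using X(2) unfolding X' v ac sym_mat_mult_vector by (simp_all only: vector3_eq_0_iff)
    then show ?thesis
      using X' ac by (auto simp: algebra_simps eq_neg_iff_add_eq_0)
  qed
  show False
  proof (cases "z = 0")
    case True
    have ah: "a = 0 \<and> h = 0" if "n * a * x + h * y = 0" "h * x + a * y = 0" for a h
    proof -
      have "a * (n * x\<^sup>2 - y\<^sup>2) = x * (n * a * x + h * y) - y * (h * x + a * y)"
        by (simp add: algebra_simps power2_eq_square)
      then have "a = 0 \<or> y\<^sup>2 = n * x\<^sup>2"
        using that by auto
      moreover have "\<not> (y = 0 \<and> x = 0)"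
        using dk True by (auto simp: double_kernel_def v)
      ultimately have "a = 0" "\<not> (y = 0 \<and> x = 0)"
        using nonsquare_anisotropic[OF n, of y x] by blast+
      then show ?thesis
        using that by auto
    qed
    show False
    proof (cases "x = 0")
      case False
      have "X = 0" if X: "X \<in> no_line_code n b d" "X *v v = 0" "X $ 2 $ 3 = 0" for X
      proof -
        obtain a h e f where X': "X = sym_mat (n * a) a (- (b * a + 2 * d * h)) h e f"
          and eqs: "n * a * x + h * y + e * z = 0" "h * x + a * y + f * z = 0"
            "e * x + f * y = (b * a + 2 * d * h) * z"
          using form[OF X(1,2)] by blast
        have "a = 0 \<and> h = 0"
          by (rule ah) (use eqs True in simp_all)
        then show ?thesis
          using eqs X(3) True False by (simp add: X')
      qed
      then show False
        using not_double_kernelI[OF sub] dk by blast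
    next
      case x: True
      then have y: "y \<noteq> 0"
        using dk True by (auto simp: double_kernel_def v)
      have "X = 0" if X: "X \<in> no_line_code n b d" "X *v v = 0" "X $ 1 $ 3 = 0" for X
      proof -
        obtain a h e f where X': "X = sym_mat (n * a) a (- (b * a + 2 * d * h)) h e f"
          and eqs: "n * a * x + h * y + e * z = 0" "h * x + a * y + f * z = 0"
            "e * x + f * y = (b * a + 2 * d * h) * z"
          using form[OF X(1,2)] by blast
        have "a = 0 \<and> h = 0"
          by (rule ah) (use eqs True in simp_all)
        then show ?thesis
          using eqs X(3) True x y by (simp add: X')
      qed
      then show False
        using not_double_kernelI[OF sub] dk by blast
    qed
  next
    case z: False
    \<comment> \<open>With \<theta> = b + 2 d \<surd>n, \<alpha> + 2 \<beta> \<surd>n equals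
      \<theta> z^2 + (y + x \<surd>n)^2. If both \<alpha> and \<beta> vanished, -\<theta> would be a
      square and so would its norm, contrary to \<open>N\<close>.\<close>
    define \<alpha> where "\<alpha> = b * z\<^sup>2 + n * x\<^sup>2 + y\<^sup>2"
    define \<beta> where "\<beta> = d * z\<^sup>2 + x * y"
    have rel: "a * \<alpha> + 2 * h * \<beta> = 0"
      if "n * a * x + h * y + e * z = 0" "h * x + a * y + f * z = 0"
        "e * x + f * y = (b * a + 2 * d * h) * z" for a h e f
    proof -
      have "a * \<alpha> + 2 * h * \<beta> = x * (n * a * x + h * y + e * z) + y * (h * x + a * y + f * z)
        - z * (e * x + f * y - (b * a + 2 * d * h) * z)"
        by (simp add: \<alpha>_def \<beta>_def algebra_simps power2_eq_square)
      then show ?thesis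
        using that by simp
    qed
    have "\<alpha> \<noteq> 0 \<or> \<beta> \<noteq> 0"
    proof (rule ccontr)
      assume "\<not> (\<alpha> \<noteq> 0 \<or> \<beta> \<noteq> 0)"
      then have 1: "b * z\<^sup>2 = - (n * x\<^sup>2 + y\<^sup>2)" and 2: "d * z\<^sup>2 = - (x * y)"
        by (simp_all only: \<alpha>_def \<beta>_def eq_neg_iff_add_eq_0 add.assoc) simp_all
      have "(b\<^sup>2 - 4 * n * d\<^sup>2) * (z\<^sup>2)\<^sup>2 = (b * z\<^sup>2)\<^sup>2 - 4 * n * (d * z\<^sup>2)\<^sup>2"
        by (simp add: algebra_simps power2_eq_square)
      also have "\<dots> = (n * x\<^sup>2 - y\<^sup>2)\<^sup>2"
        unfolding 1 2 by (simp add: algebra_simps power2_eq_square)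
      finally have "b\<^sup>2 - 4 * n * d\<^sup>2 = ((n * x\<^sup>2 - y\<^sup>2) / z\<^sup>2)\<^sup>2"
        using z by (simp add: power_divide eq_divide_eq)
      then show False
        using N by blast
    qed
    then show False
    proof
      assume \<alpha>: "\<alpha> \<noteq> 0"
      have "X = 0" if X: "X \<in> no_line_code n b d" "X *v v = 0" "X $ 1 $ 2 = 0" for X
      proof -
        obtain a h e f where X': "X = sym_mat (n * a) a (- (b * a + 2 * d * h)) h e f"
          and eqs: "n * a * x + h * y + e * z = 0" "h * x + a * y + f * z = 0"
            "e * x + f * y = (b * a + 2 * d * h) * z"
          using form[OF X(1,2)] by blast
        have h: "h = 0"
          using X(3) by (simp add: X')
        then have "a = 0"
          using rel[OF eqs] \<alpha> by simp
        then show ?thesis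
          using eqs h z by (simp add: X')
      qed
      then show False
        using not_double_kernelI[OF sub] dk by blast
    next
      assume \<beta>: "\<beta> \<noteq> 0"
      have "X = 0" if X: "X \<in> no_line_code n b d" "X *v v = 0" "X $ 2 $ 2 = 0" for X
      proof -
        obtain a h e f where X': "X = sym_mat (n * a) a (- (b * a + 2 * d * h)) h e f"
          and eqs: "n * a * x + h * y + e * z = 0" "h * x + a * y + f * z = 0"
            "e * x + f * y = (b * a + 2 * d * h) * z"
          using form[OF X(1,2)] by blast
        have a: "a = 0"
          using X(3) by (simp add: X')
        then have "h = 0"
          using rel[OF eqs] \<beta> two by simp
        then show ?thesis
          using eqs a z by (simp add: X')
      qed
      then show False
        using not_double_kernelI[OF sub] dk by blast
    qed
  qed
qed

section \<open>Completeness of the three codes, and their separation\<close>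

lemma linear_CSRD_pencil_perp:
  fixes P Q :: "'a::{field,finite}^3^3"
  assumes "(2::'a) \<noteq> 0" "base_free P Q" "card (pencil_perp P Q) = CARD('a) ^ 4"
  shows "linear_CSRD 2 (pencil_perp P Q)"
  unfolding linear_CSRD_2_iff[OF assms(1)]
  using assms subspace_pencil_perp rank_one_free_pencil_perp_iff by (auto simp: pencil_perp_def)

lemma base_freeI_vector:
  assumes "\<And>x y z. qform P (vector [x, y, z]) = 0 \<Longrightarrow> qform Q (vector [x, y, z]) = 0 \<Longrightarrow>
    x = 0 \<and> y = 0 \<and> z = 0"
  shows "base_free P Q"
  unfolding base_free_def by (metis assms vector3_cases vector3_eq_0_iff)

lemma linear_CSRD_double_line_code:
  fixes n :: "'a::{field,finite}"
  assumes "(2::'a) \<noteq> 0" "\<nexists>r. n = r\<^sup>2"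
  shows "linear_CSRD 2 (double_line_code n)"
  unfolding double_line_code_def
proof (rule linear_CSRD_pencil_perp[OF assms(1)])
  show "base_free (sym_mat 1 0 0 0 0 0) (sym_mat 0 1 (- n) 0 0 0)"
    by (rule base_freeI_vector) (use nonsquare_anisotropic[OF assms(2)] in auto)
  show "card (pencil_perp (sym_mat 1 0 0 0 0 0) (sym_mat 0 1 (- n) 0 0 0)) = CARD('a) ^ 4"
    by (rule card_pencil_perp[of "sym_mat 1 0 0 0 0 0" _ "sym_mat 0 1 0 0 0 0"])
      (simp_all add: trace_sym_mat_mult)
qed

lemma linear_CSRD_line_pair_code:
  fixes n :: "'a::{field,finite}"
  assumes two: "(2::'a) \<noteq> 0" and n: "\<nexists>r. n = r\<^sup>2"
  shows "linear_CSRD 2 (line_pair_code n)"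
  unfolding line_pair_code_def
proof (rule linear_CSRD_pencil_perp[OF two])
  show "base_free (sym_mat 0 0 0 1 0 0) (sym_mat (- n) (- n) 1 0 0 0)"
  proof (rule base_freeI_vector)
    fix x y z
    assume "qform (sym_mat 0 0 0 1 0 0) (vector [x, y, z]) = 0"
      and Q: "qform (sym_mat (- n) (- n) 1 0 0 0) (vector [x, y, z]) = 0"
    then have "x = 0 \<or> y = 0"
      using two by simp
    then show "x = 0 \<and> y = 0 \<and> z = 0"
      using Q nonsquare_anisotropic[OF n, of z x] nonsquare_anisotropic[OF n, of z y] by auto
  qed
  show "card (pencil_perp (sym_mat 0 0 0 1 0 0) (sym_mat (- n) (- n) 1 0 0 0)) = CARD('a) ^ 4"
    by (rule card_pencil_perp[of "sym_mat 0 0 0 1 0 0" _ "sym_mat 0 0 1 0 0 0"])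
      (use two in \<open>simp_all add: trace_sym_mat_mult\<close>)
qed

lemma linear_CSRD_no_line_code:
  fixes n :: "'a::{field,finite}"
  assumes two: "(2::'a) \<noteq> 0" and n: "\<nexists>r. n = r\<^sup>2"
  shows "linear_CSRD 2 (no_line_code n b d)"
  unfolding no_line_code_def
proof (rule linear_CSRD_pencil_perp[OF two])
  show "base_free (sym_mat 1 (- n) 0 0 0 0) (sym_mat 0 b 1 d 0 0)"
  proof (rule base_freeI_vector)
    fix x y z
    assume "qform (sym_mat 1 (- n) 0 0 0 0) (vector [x, y, z]) = 0"
      and Q: "qform (sym_mat 0 b 1 d 0 0) (vector [x, y, z]) = 0"
    then have "x = 0 \<and> y = 0"
      by (intro nonsquare_anisotropic[OF n]) simp
    then show "x = 0 \<and> y = 0 \<and> z = 0"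
      using Q by simp
  qed
  show "card (pencil_perp (sym_mat 1 (- n) 0 0 0 0) (sym_mat 0 b 1 d 0 0)) = CARD('a) ^ 4"
    by (rule card_pencil_perp[of "sym_mat 1 0 0 0 0 0" _ "sym_mat 0 0 1 0 0 0"])
      (simp_all add: trace_sym_mat_mult)
qed

lemma not_equivalent_no_line_code:
  fixes n b d :: "'a::{field,finite}"
  assumes "(2::'a) \<noteq> 0" "\<nexists>r. n = r\<^sup>2" "\<nexists>r. b\<^sup>2 - 4 * n * d\<^sup>2 = r\<^sup>2" "double_kernel C v"
  shows "\<not> code_equivalent C (no_line_code n b d)"
  using double_kernel_equivalent not_double_kernel_no_line_code[OF assms(1-3)] assms(4) by metis

text \<open>An equivalence would give an invertible B sending both (1, 0, 0) and (0, 1, 0) into the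
  line spanned by (1, 0, 0).\<close>

lemma not_equivalent_line_pair_double_line:
  fixes n :: "'a::{field,finite}"
  assumes n: "\<nexists>r. n = r\<^sup>2"
  shows "\<not> code_equivalent (line_pair_code n) (double_line_code n)"
proof
  assume "code_equivalent (line_pair_code n) (double_line_code n)"
  then obtain B where B: "invertible B"
    "\<And>v. double_kernel (line_pair_code n) v \<Longrightarrow> double_kernel (double_line_code n) (B *v v)"
    using double_kernel_equivalent by blast
  have "(B *v v) $ 2 = 0 \<and> (B *v v) $ 3 = 0" if v: "double_kernel (line_pair_code n) v" for v
  proof -
    obtain x y z where xyz: "B *v v = vector [x, y, z]"
      by (rule vector3_cases)
    then show ?thesis
      using double_kernel_double_line_codeD[OF n, of x y z] B(2)[OF v] by simp
  qed
  from this[OF double_kernel_line_pair_code(1)] this[OF double_kernel_line_pair_code(2)]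
  have "B $ 2 $ 1 = 0" "B $ 3 $ 1 = 0" "B $ 2 $ 2 = 0" "B $ 3 $ 2 = 0"
    by (simp_all add: matrix_vector_mult_def sum_3)
  then have "det B = 0"
    by (simp add: det_3)
  then show False
    using B(1) invertible_det_nz by blast
qed

section \<open>Counting the equivalence classes\<close>

theorem theorem1p2:
  assumes "odd CARD('a::{field,finite})"
  shows "card ((CSRD_codes 2 :: ('a^3^3) set set) // CSRD_equiv 2) = 3 \<and>
    (\<forall>C :: ('a^3^3) set. linear_CSRD 2 C \<longrightarrow> linear_MSRD2 C)"
proof
  have two: "(2::'a) \<noteq> 0"
    using assms by (rule two_neq_0_of_odd_CARD)
  obtain n :: 'a where n: "\<nexists>r. n = r\<^sup>2"
    using exists_nonsquare[OF two] .
  have n0: "n \<noteq> 0"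
    using n by (metis power_zero_numeral)
  \<comment> \<open>The norm b^2 - 4 n d^2 only has to be a nonsquare; the value n is reached
    because b^2 - n y^2 is universal, with y = 2 d.\<close>
  obtain b y where by': "1 * b\<^sup>2 + (- n) * y\<^sup>2 = n"
    using diagonal_binary_form_universal[OF two, of 1 "- n" n] n0 by auto
  define d where "d = y / 2"
  have "b\<^sup>2 - 4 * n * d\<^sup>2 = n"
  proof -
    have "y = 2 * d"
      using two by (simp add: d_def)
    then show ?thesis
      using by' by (simp add: power2_eq_square algebra_simps)
  qed
  then have N: "\<nexists>r. b\<^sup>2 - 4 * n * d\<^sup>2 = r\<^sup>2"
    using n by simp
  let ?E = "CSRD_equiv 2 :: (('a^3^3) set \<times> ('a^3^3) set) set"
  let ?A = "no_line_code n b d" and ?B = "double_line_code n" and ?C = "line_pair_code n"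
  note eqv = equiv_CSRD_equiv[of 2, where 'a='a]
  have codes: "?A \<in> CSRD_codes 2" "?B \<in> CSRD_codes 2" "?C \<in> CSRD_codes 2"
    using linear_CSRD_no_line_code[OF two n] linear_CSRD_double_line_code[OF two n]
      linear_CSRD_line_pair_code[OF two n] by (simp_all add: CSRD_codes_def)
  have "(CSRD_codes 2) // ?E = {?E `` {?A}, ?E `` {?B}, ?E `` {?C}}"
  proof (intro equalityI subsetI)
    fix K assume "K \<in> (CSRD_codes 2) // ?E"
    then obtain C where C: "C \<in> CSRD_codes 2" and K: "K = ?E `` {C}"
      by (rule quotientE)
    then obtain P Q where PQ: "P \<in> Sym3" "Q \<in> Sym3" "base_free P Q" "C = pencil_perp P Q"
      using linear_CSRD_2_imp_pencil_perp[OF two, of C] by (auto simp: CSRD_codes_def)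
    then have "classified n b d C"
      using base_free_pencil_classification[OF two n N] by blast
    then have "(C, ?A) \<in> ?E \<or> (C, ?B) \<in> ?E \<or> (C, ?C) \<in> ?E"
      using C codes by (auto simp: classified_def CSRD_equiv_def)
    then have "K = ?E `` {?A} \<or> K = ?E `` {?B} \<or> K = ?E `` {?C}"
      unfolding K by (meson equiv_class_eq[OF eqv])
    then show "K \<in> {?E `` {?A}, ?E `` {?B}, ?E `` {?C}}"
      by (simp only: insert_iff empty_iff simp_thms)
  next
    fix K assume "K \<in> {?E `` {?A}, ?E `` {?B}, ?E `` {?C}}"
    then consider "K = ?E `` {?A}" | "K = ?E `` {?B}" | "K = ?E `` {?C}"
      by (simp only: insert_iff empty_iff simp_thms) metis
    then show "K \<in> (CSRD_codes 2) // ?E"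
      by cases (simp_all only: quotientI codes)
  qed
  moreover have distinct: "?E `` {D} \<noteq> ?E `` {D'}"
    if "D' \<in> CSRD_codes 2" "\<not> code_equivalent D D'" for D D'
    using eq_equiv_class[OF _ eqv that(1)] that(2) by (auto simp: CSRD_equiv_def)
  \<comment> \<open>Double kernels are carried forwards along an equivalence, so in each pair the
    code with more of them comes first.\<close>
  have "?E `` {?B} \<noteq> ?E `` {?A}" "?E `` {?C} \<noteq> ?E `` {?A}" "?E `` {?C} \<noteq> ?E `` {?B}"
    using distinct[OF codes(1)] distinct[OF codes(2)] not_equivalent_line_pair_double_line[OF n]
      not_equivalent_no_line_code[OF two n N double_kernel_double_line_code]
      not_equivalent_no_line_code[OF two n N double_kernel_line_pair_code(1)] by blast+
  ultimately show "card ((CSRD_codes 2 :: ('a^3^3) set set) // CSRD_equiv 2) = 3"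
    by simp
  show "\<forall>C :: ('a^3^3) set. linear_CSRD 2 C \<longrightarrow> linear_MSRD2 C"
  proof (intro allI impI)
    fix C :: "('a^3^3) set" assume L: "linear_CSRD 2 C"
    then have "CARD('a) ^ matvs.dim C = CARD('a) ^ 4"
      using linear_CSRD_2_iff[OF two, of C] card_subspace_eq_power_dim[of C] by simp
    then have "matvs.dim C = 4"
      using CARD_field_ge_2[where 'a='a] by simp
    then show "linear_MSRD2 C"
      using L by (simp add: linear_MSRD2_def linear_CSRD_def)
  qed
qed

end
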